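(* Let $f$ and $g$ be $C^2$-harmonic mappings defined on a domain $\Omega\subset\mathbb{R}^n$, corresponding to the same function $H$ and with the same boundary data in $C^0(\partial\Omega)$. Suppose that $H=H(u)$ is $C^3$, non-increasing, and satisfies $$H'''H'\big(1+(H')^2\big)+(H'')^2\big(1-(H')^2\big)\le0$$ and $$H'''(u+HH')\big(1+(H')^2\big)+(H'')^2\big(1-(H')^2\big)+H''\big(1+(H')^2-2uH'\big)\le0 .$$ Then $f\equiv g$ in $\overline\Omega$.
   Context: The first Heisenberg group $\mathbb{H}^1$ is $\mathbb{R}^3$ with coordinates $(\mathsf{x},\mathsf{y},\mathsf{t})$ and contact form $\theta=d\mathsf{t}+2(\mathsf{x}\,d\mathsf{y}-\mathsf{y}\,d\mathsf{x})$. Let $\Omega\subset\mathbb{R}^n$ be a domain. A harmonic curve (also called $C^2$-harmonic mapping) is a $C^2$ map $f=(\mathsf{x},\mathsf{y},\mathsf{t}):\Omega\to\mathbb{H}^1$, also written $f=(\mathsf{z},\mathsf{t})$ with $\mathsf{z}=\mathsf{x}+i\mathsf{y}$, such that: (1) (isotropicity) $\frac{\partial\mathsf{x}}{\partial x_\alpha}\frac{\partial\mathsf{y}}{\partial x_\beta}-\frac{\partial\mathsf{x}}{\partial x_\beta}\frac{\partial\mathsf{y}}{\partial x_\alpha}=0$ for all $\alpha<\beta$, and the contact condition $f^*\theta=0$ holds, i.e. $\nabla\mathsf{t}=2(\mathsf{y}\nabla\mathsf{x}-\mathsf{x}\nabla\mathsf{y})$; (2) (criticality) $\mathsf{z}$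 is a critical point of $E^2(f)=\int_\Omega|\nabla\mathsf{z}|^2dx$, where $|\nabla\mathsf{z}|^2=|\nabla\mathsf{x}|^2+|\nabla\mathsf{y}|^2$, with respect to domain variations $\mathsf{z}_s(x)=\mathsf{z}(x+s\xi(x))$, $\xi\in C_0^\infty(\Omega,\mathbb{R}^n)$; that is, for all $\phi\in C_0^\infty(\Omega)$ and $\gamma=1,\dots,n$, $$\int_\Omega\Big(|\nabla\mathsf{z}|^2\frac{\partial\phi}{\partial x_\gamma}-2\sum_{\beta=1}^n\Big(\frac{\partial\mathsf{x}}{\partial x_\beta}\frac{\partial\mathsf{x}}{\partial x_\gamma}+\frac{\partial\mathsf{y}}{\partial x_\beta}\frac{\partial\mathsf{y}}{\partial x_\gamma}\Big)\frac{\partial\phi}{\partial x_\beta}\Big)dx=0.$$ The mapping corresponds to $H$ if $\mathsf{x}=H\circ\mathsf{y}$, where $H:I\to\mathbb{R}$ is a (at least $C^2$) function on an interval $I\supset\mathsf{y}(\Omega)$. For such maps, criticality is equivalent to $$\Delta\mathsf{y}=-\frac{(H''\circ\mathsf{y})(H'\circ\mathsf{y})}{1+(H'\circ\mathsf{y})^2}|\nabla\mathsf{y}|^2\quad\text{in }\Omega.$$ The two differential inequalities in the claim are required on the domain of $H$ ($u$ is the variable of $H$). Having the same boundary data in $C^0(\partial\Omega)$ means that $f$ and $g$ extend continuously to $\overline\Omega$ and agree on $\partial\Omega$.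
   Formalization: The domain Ω is additionally assumed bounded; for unbounded Ω the claim fails, e.g. H = 0, f = (0,0,0), g = (0,x_1,0) on the half-space x_1 > 0. *)

theory Defs
  imports "HOL-Analysis.Analysis"
begin

definition partial_deriv :: "'n \<Rightarrow> (real ^ 'n \<Rightarrow> 'b::real_normed_vector) \<Rightarrow> real ^ 'n \<Rightarrow> 'b"
  where "partial_deriv i f p = frechet_derivative f (at p) (axis i 1)"

text \<open>Class \<open>C\<^sup>k\<close>; meant for open \<open>S\<close>, where differentiability within \<open>S\<close> is
  differentiability at the points of \<open>S\<close>.\<close>

primrec Ck_on :: "nat \<Rightarrow> (real ^ 'n \<Rightarrow> 'b::real_normed_vector) \<Rightarrow> (real ^ 'n) set \<Rightarrow> bool"
  where
    "Ck_on 0 f S \<longleftrightarrow> continuous_on S f"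
  | "Ck_on (Suc k) f S \<longleftrightarrow> f differentiable_on S \<and> (\<forall>i. Ck_on k (partial_deriv i f) S)"

text \<open>Elements of \<open>C\<^sub>0\<^sup>\<infinity>(\<Omega>)\<close> are represented by their extensions by zero to the whole space.\<close>

definition test_function :: "(real ^ 'n) set \<Rightarrow> (real ^ 'n \<Rightarrow> real) \<Rightarrow> bool"
  where "test_function \<Omega> \<phi> \<longleftrightarrow>
    (\<forall>k. Ck_on k \<phi> UNIV) \<and>
    compact (closure (support_on UNIV \<phi>)) \<and> closure (support_on UNIV \<phi>) \<subseteq> \<Omega>"

text \<open>The first Heisenberg group has underlying space \<open>real ^ 3\<close>, with coordinates
  \<open>x = p $ 1\<close>, \<open>y = p $ 2\<close>, \<open>t = p $ 3\<close>. The contact form is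
  \<open>\<theta> = dt + 2 (x dy - y dx)\<close>, at the point \<open>p\<close> applied to the vector \<open>v\<close>.\<close>

definition contact_form :: "real ^ 3 \<Rightarrow> real ^ 3 \<Rightarrow> real"
  where "contact_form p v = v $ 3 + 2 * (p $ 1 * v $ 2 - p $ 2 * v $ 1)"

text \<open>Quantifying over all pairs of indices rather than over \<open>\<alpha> < \<beta>\<close> changes nothing, since the
  Jacobian is antisymmetric in them.\<close>

definition isotropic :: "(real ^ 'n \<Rightarrow> real ^ 3) \<Rightarrow> (real ^ 'n) set \<Rightarrow> bool"
  where "isotropic f \<Omega> \<longleftrightarrow>
    (let x = (\<lambda>p. f p $ 1); y = (\<lambda>p. f p $ 2) in
      (\<forall>p\<in>\<Omega>. \<forall>\<alpha> \<beta>. partial_deriv \<alpha> x p * partial_deriv \<beta> y p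
                    - partial_deriv \<beta> x p * partial_deriv \<alpha> y p = 0) \<and>
      (\<forall>p\<in>\<Omega>. \<forall>v. contact_form (f p) (frechet_derivative f (at p) v) = 0))"

text \<open>Vanishing of the first variation of the energy (the integral over \<open>\<Omega>\<close> of
  \<open>\<bar>\<nabla>z\<bar>\<^sup>2\<close>, \<open>z = x + i y\<close>) under the domain variations \<open>z(p + s \<xi>(p))\<close>,
  tested with the fields \<open>\<xi>\<close> whose only nonzero component is \<open>\<phi>\<close> in direction \<open>\<gamma>\<close>.\<close>

definition energy_critical :: "(real ^ 'n \<Rightarrow> real ^ 3) \<Rightarrow> (real ^ 'n) set \<Rightarrow> bool"
  where "energy_critical f \<Omega> \<longleftrightarrow>
    (let x = (\<lambda>p. f p $ 1); y = (\<lambda>p. f p $ 2) in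
      \<forall>\<phi> \<gamma>. test_function \<Omega> \<phi> \<longrightarrow>
        (LINT p:\<Omega>|lborel.
           (\<Sum>\<alpha>\<in>UNIV. (partial_deriv \<alpha> x p)\<^sup>2 + (partial_deriv \<alpha> y p)\<^sup>2) * partial_deriv \<gamma> \<phi> p
           - 2 * (\<Sum>\<beta>\<in>UNIV. (partial_deriv \<beta> x p * partial_deriv \<gamma> x p
                              + partial_deriv \<beta> y p * partial_deriv \<gamma> y p)
                            * partial_deriv \<beta> \<phi> p)) = 0)"

definition harmonic_curve :: "(real ^ 'n \<Rightarrow> real ^ 3) \<Rightarrow> (real ^ 'n) set \<Rightarrow> bool"
  where "harmonic_curve f \<Omega> \<longleftrightarrow> Ck_on 2 f \<Omega> \<and> isotropic f \<Omega> \<and> energy_critical f \<Omega>"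

text \<open>Class \<open>C\<^sup>k\<close> on an interval \<open>I\<close>, with one-sided derivatives at endpoints that belong
  to \<open>I\<close>. The interval must have more than one point for the derivatives to be unique.\<close>

primrec Ck_interval :: "nat \<Rightarrow> real set \<Rightarrow> (real \<Rightarrow> real) \<Rightarrow> bool"
  where
    "Ck_interval 0 I h \<longleftrightarrow> continuous_on I h"
  | "Ck_interval (Suc k) I h \<longleftrightarrow>
       (\<exists>h'. (\<forall>u\<in>I. (h has_real_derivative h' u) (at u within I)) \<and> Ck_interval k I h')"

definition corresponds_to ::
    "(real ^ 'n \<Rightarrow> real ^ 3) \<Rightarrow> (real ^ 'n) set \<Rightarrow> real set \<Rightarrow> (real \<Rightarrow> real) \<Rightarrow> bool"
  where "corresponds_to f \<Omega> I H \<longleftrightarrow>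
    is_interval I \<and> interior I \<noteq> {} \<and> Ck_interval 2 I H \<and>
    (\<lambda>p. f p $ 2) ` \<Omega> \<subseteq> I \<and> (\<forall>p\<in>\<Omega>. f p $ 1 = H (f p $ 2))"

end

theory Submission
  imports Defs "HOL-Computational_Algebra.Polynomial"
begin

text \<open>Let \<open>F\<close> be the arc length of the graph of \<open>H\<close>, so \<open>F' = sqrt (1 + H'\<^sup>2)\<close>. The curve
  \<open>z = (H \<circ> y, y)\<close> is then \<open>w = F \<circ> y\<close> in arc length parameter, the criticality of \<open>z\<close> is that of \<open>w\<close>,
  and this forces \<open>\<Delta>w = 0\<close>. Because \<open>H\<close> is non-increasing,
  \<open>\<bar>u - v\<bar> \<le> \<bar>F u - F v\<bar> \<le> \<bar>u - v\<bar> + \<bar>H u - H v\<bar>\<close>: the upper bound shows that the difference of the two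
  harmonic functions tends to zero at the boundary even where \<open>y\<close> leaves \<open>I\<close>, and the lower bound that
  equality of the \<open>w\<close> implies equality of the \<open>y\<close>. The contact condition then determines the gradient
  of \<open>t\<close>.\<close>

subsection \<open>Calculus of \<open>C\<^sup>k\<close> functions\<close>

lemma partial_deriv_eq:
  assumes "(f has_derivative f') (at p)"
  shows "partial_deriv i f p = f' (axis i 1)"
  unfolding partial_deriv_def using frechet_derivative_at[OF assms] by simp

lemma partial_deriv_cong:
  assumes "open S" "p \<in> S" "\<And>q. q \<in> S \<Longrightarrow> f q = g q"
  shows "partial_deriv i f p = partial_deriv i g p"
proof -
  have "(f has_derivative f') (at p) \<longleftrightarrow> (g has_derivative f') (at p)" for f'
    using assms has_derivative_transform_within_open[of f f' p UNIV S g]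
      has_derivative_transform_within_open[of g f' p UNIV S f] by auto
  then show ?thesis
    by (simp add: partial_deriv_def frechet_derivative_def)
qed

lemma partial_deriv_const [simp]: "partial_deriv i (\<lambda>_. c) = (\<lambda>_. 0)"
  by (rule ext) (simp add: partial_deriv_eq[OF has_derivative_const])

lemma partial_deriv_add:
  assumes "f differentiable at p" "g differentiable at p"
  shows "partial_deriv i (\<lambda>q. f q + g q) p = partial_deriv i f p + partial_deriv i g p"
  using partial_deriv_eq[OF has_derivative_add[OF assms[unfolded frechet_derivative_works]]]
  by (simp add: partial_deriv_def)

lemma partial_deriv_mult:
  fixes f g :: "real ^ 'n \<Rightarrow> real"
  assumes "f differentiable at p" "g differentiable at p"
  shows "partial_deriv i (\<lambda>q. f q * g q) p = partial_deriv i f p * g p + f p * partial_deriv i g p"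
  using partial_deriv_eq[OF has_derivative_mult[OF assms[unfolded frechet_derivative_works]]]
  by (simp add: partial_deriv_def algebra_simps)

lemma partial_deriv_diff:
  assumes "f differentiable at p" "g differentiable at p"
  shows "partial_deriv i (\<lambda>q. f q - g q) p = partial_deriv i f p - partial_deriv i g p"
  using partial_deriv_eq[OF has_derivative_diff[OF assms[unfolded frechet_derivative_works]]]
  by (simp add: partial_deriv_def)

lemma partial_deriv_sum:
  assumes "\<And>a. a \<in> A \<Longrightarrow> f a differentiable at p"
  shows "partial_deriv i (\<lambda>q. \<Sum>a\<in>A. f a q) p = (\<Sum>a\<in>A. partial_deriv i (f a) p)"
  using partial_deriv_eq[OF has_derivative_sum[of A f, OF assms[unfolded frechet_derivative_works]]]
  by (simp add: partial_deriv_def)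

lemma partial_deriv_vec_nth:
  assumes "f differentiable at p"
  shows "partial_deriv i (\<lambda>q. f q $ j) p = partial_deriv i f p $ j"
  using partial_deriv_eq[OF bounded_linear.has_derivative[OF bounded_linear_vec_nth
        assms[unfolded frechet_derivative_works]]]
  by (simp add: partial_deriv_def)

text \<open>The outer function is only differentiable within \<open>I\<close>, possibly one-sidedly
  at an endpoint. This suffices because \<open>f\<close> maps the open set \<open>S\<close> into
  \<open>I\<close>, and at a point of \<open>S\<close> the derivative within \<open>S\<close> is the
  full derivative.\<close>

lemma partial_deriv_compose:
  assumes "open S" "p \<in> S" "f differentiable at p" "\<And>q. q \<in> S \<Longrightarrow> f q \<in> I"
    and "(h has_real_derivative d) (at (f p) within I)"
  shows "(\<lambda>q. h (f q)) differentiable at p"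
    and "partial_deriv i (\<lambda>q. h (f q)) p = d * partial_deriv i f p"
proof -
  let ?D = "frechet_derivative f (at p)"
  have "(f has_derivative ?D) (at p within S)"
    using assms(3) frechet_derivative_works has_derivative_at_withinI by blast
  moreover have "(h has_derivative (*) d) (at (f p) within f ` S)"
    using assms(4,5) has_derivative_subset[of h "(*) d" "f p" I "f ` S"]
    by (auto simp: has_field_derivative_def)
  ultimately have "((\<lambda>q. h (f q)) has_derivative (\<lambda>v. d * ?D v)) (at p within S)"
    using has_derivative_in_compose by blast
  then have *: "((\<lambda>q. h (f q)) has_derivative (\<lambda>v. d * ?D v)) (at p)"
    using assms(1,2) at_within_open by metis
  then show "(\<lambda>q. h (f q)) differentiable at p"
    by (auto simp: differentiable_def)
  show "partial_deriv i (\<lambda>q. h (f q)) p = d * partial_deriv i f p"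
    using partial_deriv_eq[OF *] by (simp add: partial_deriv_def)
qed

text \<open>Reduces partial derivatives to derivatives in one real variable, so that the mean value
  theorem applies to them.\<close>

lemma partial_deriv_along_line:
  fixes f :: "real ^ 'n \<Rightarrow> real"
  assumes "f differentiable at (p + s *\<^sub>R axis i 1)"
  shows "((\<lambda>s. f (p + s *\<^sub>R axis i 1)) has_real_derivative
          partial_deriv i f (p + s *\<^sub>R axis i 1)) (at s)"
proof -
  let ?q = "p + s *\<^sub>R axis i 1"
  let ?D = "frechet_derivative f (at ?q)"
  have D: "(f has_derivative ?D) (at ?q)"
    using assms frechet_derivative_works by blast
  have "((\<lambda>s. p + s *\<^sub>R axis i 1) has_derivative (\<lambda>t. t *\<^sub>R axis i 1)) (at s)"
    by (auto intro!: derivative_eq_intros)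
  then have "((\<lambda>s. f (p + s *\<^sub>R axis i 1)) has_derivative (\<lambda>t. ?D (t *\<^sub>R axis i 1))) (at s)"
    using D by (rule has_derivative_compose)
  moreover have "(\<lambda>t. ?D (t *\<^sub>R axis i 1)) = (*) (partial_deriv i f ?q)"
    using linear_cmul[OF has_derivative_linear[OF D]]
    by (auto simp: partial_deriv_def fun_eq_iff)
  ultimately show ?thesis
    by (simp only: has_field_derivative_def)
qed

section \<open>Closure properties of the classes C^k\<close>

lemma differentiable_on_cong:
  assumes "\<And>q. q \<in> S \<Longrightarrow> f q = g q" "f differentiable_on S"
  shows "g differentiable_on S"
  using assms has_derivative_transform unfolding differentiable_on_def differentiable_def by metis

lemma differentiable_on_openD:
  "f differentiable_on S \<Longrightarrow> open S \<Longrightarrow> p \<in> S \<Longrightarrow> f differentiable at p"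
  by (simp add: differentiable_on_eq_differentiable_at)

lemma Ck_on_cong:
  assumes "open S" "\<And>q. q \<in> S \<Longrightarrow> f q = g q" "Ck_on k f S"
  shows "Ck_on k g S"
  using assms(2,3)
proof (induction k arbitrary: f g)
  case 0
  then show ?case by (simp cong: continuous_on_cong)
next
  case (Suc k)
  have "Ck_on k (partial_deriv i g) S" for i
  proof (rule Suc.IH[of "partial_deriv i f"])
    show "partial_deriv i f q = partial_deriv i g q" if "q \<in> S" for q
      using assms(1) that Suc.prems(1) by (rule partial_deriv_cong)
  qed (use Suc.prems(2) in simp)
  moreover have "g differentiable_on S"
    using Suc.prems by (intro differentiable_on_cong[of S f g]) auto
  ultimately show ?case by simp
qed

lemma Ck_on_Suc_D: "Ck_on (Suc k) f S \<Longrightarrow> Ck_on k f S"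
  by (induction k arbitrary: f) (auto simp: differentiable_imp_continuous_on)

lemma Ck_on_subset: "Ck_on k f S \<Longrightarrow> T \<subseteq> S \<Longrightarrow> Ck_on k f T"
  by (induction k arbitrary: f) (auto intro: continuous_on_subset differentiable_on_subset)

text \<open>Continuity and differentiability are local on open sets. This serves to glue a compactly
  supported function to its extension by zero.\<close>

lemma Ck_on_open_Un:
  assumes "open S" "open T" "Ck_on k f S" "Ck_on k f T"
  shows "Ck_on k f (S \<union> T)"
  using assms(3,4)
proof (induction k arbitrary: f)
  case 0
  then show ?case using assms by (simp add: continuous_on_open_Un)
next
  case (Suc k)
  then show ?case
    using assms(1,2) by (auto simp: differentiable_on_eq_differentiable_at open_Un)
qed

lemma Ck_on_const: "Ck_on k (\<lambda>_. c) S"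
  by (induction k arbitrary: c) auto

lemma Ck_on_add:
  assumes "open S" "Ck_on k f S" "Ck_on k g S"
  shows "Ck_on k (\<lambda>p. f p + g p) S"
  using assms(2,3)
proof (induction k arbitrary: f g)
  case 0
  then show ?case by (simp add: continuous_on_add)
next
  case (Suc k)
  have "Ck_on k (partial_deriv i (\<lambda>p. f p + g p)) S" for i
  proof (rule Ck_on_cong[OF assms(1)])
    show "Ck_on k (\<lambda>p. partial_deriv i f p + partial_deriv i g p) S"
      using Suc.prems by (intro Suc.IH) auto
  qed (use Suc.prems in \<open>simp add: partial_deriv_add differentiable_on_openD[OF _ assms(1)]\<close>)
  then show ?case using Suc.prems by (auto intro: differentiable_on_add)
qed

lemma Ck_on_diff:
  assumes "open S" "Ck_on k f S" "Ck_on k g S"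
  shows "Ck_on k (\<lambda>p. f p - g p) S"
  using assms(2,3)
proof (induction k arbitrary: f g)
  case 0
  then show ?case by (simp add: continuous_on_diff)
next
  case (Suc k)
  have "Ck_on k (partial_deriv i (\<lambda>p. f p - g p)) S" for i
  proof (rule Ck_on_cong[OF assms(1)])
    show "Ck_on k (\<lambda>p. partial_deriv i f p - partial_deriv i g p) S"
      using Suc.prems by (intro Suc.IH) auto
  qed (use Suc.prems in \<open>simp add: partial_deriv_diff differentiable_on_openD[OF _ assms(1)]\<close>)
  then show ?case using Suc.prems by (auto intro: differentiable_on_diff)
qed

lemma Ck_on_mult:
  fixes f g :: "real ^ 'n \<Rightarrow> real"
  assumes "open S" "Ck_on k f S" "Ck_on k g S"
  shows "Ck_on k (\<lambda>p. f p * g p) S"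
  using assms(2,3)
proof (induction k arbitrary: f g)
  case 0
  then show ?case by (simp add: continuous_on_mult)
next
  case (Suc k)
  have "Ck_on k (partial_deriv i (\<lambda>p. f p * g p)) S" for i
  proof (rule Ck_on_cong[OF assms(1)])
    \<comment> \<open>The product rule leaves undifferentiated factors, which are of class k + 1 and
      have to be lowered to class k.\<close>
    show "Ck_on k (\<lambda>p. partial_deriv i f p * g p + f p * partial_deriv i g p) S"
      using Suc.prems Ck_on_Suc_D[OF Suc.prems(1)] Ck_on_Suc_D[OF Suc.prems(2)]
      by (intro Ck_on_add[OF assms(1)] Suc.IH) auto
  qed (use Suc.prems in \<open>simp add: partial_deriv_mult differentiable_on_openD[OF _ assms(1)]\<close>)
  then show ?case using Suc.prems by (auto intro: differentiable_on_mult)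
qed

lemma Ck_on_sum:
  assumes "open S" "finite A" "\<And>a. a \<in> A \<Longrightarrow> Ck_on k (f a) S"
  shows "Ck_on k (\<lambda>p. \<Sum>a\<in>A. f a p) S"
  using assms(2,3) by (induction rule: finite_induct) (auto intro: Ck_on_const Ck_on_add[OF assms(1)])

lemma Ck_on_vec_nth:
  assumes "open S" "Ck_on k f S"
  shows "Ck_on k (\<lambda>p. f p $ j) S"
  using assms(2)
proof (induction k arbitrary: f)
  case 0
  then show ?case by (simp add: continuous_on_component)
next
  case (Suc k)
  have "Ck_on k (partial_deriv i (\<lambda>p. f p $ j)) S" for i
  proof (rule Ck_on_cong[OF assms(1)])
    show "Ck_on k (\<lambda>p. partial_deriv i f p $ j) S"
      using Suc.prems by (intro Suc.IH) auto
  qed (use Suc.prems in \<open>simp add: partial_deriv_vec_nth differentiable_on_openD[OF _ assms(1)]\<close>)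
  moreover have "(\<lambda>p. f p $ j) differentiable_on S"
    using Suc.prems bounded_linear.has_derivative[OF bounded_linear_vec_nth]
    unfolding Ck_on.simps differentiable_on_def differentiable_def by blast
  ultimately show ?case by simp
qed

lemma Ck_on_vec_nth_id: "Ck_on k (\<lambda>p. p $ j) S"
proof (cases k)
  case (Suc m)
  have "partial_deriv i (\<lambda>p. p $ j) = (\<lambda>_. axis i 1 $ j)" for i
    by (rule ext, rule partial_deriv_eq, rule bounded_linear_imp_has_derivative)
       (rule bounded_linear_vec_nth)
  with Suc show ?thesis
    by (simp add: Ck_on_const bounded_linear_imp_differentiable_on[OF bounded_linear_vec_nth])
qed (simp add: continuous_on_component continuous_on_id)

text \<open>The induction varies \<open>h\<close> while \<open>f\<close> stays fixed:
  differentiating replaces \<open>h\<close> by \<open>h'\<close> and produces the factor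
  \<open>partial_deriv i f\<close>, which is still of class k.\<close>

lemma Ck_on_compose:
  assumes "open S" "Ck_on k f S" "Ck_interval k I h" "\<And>q. q \<in> S \<Longrightarrow> f q \<in> I"
  shows "Ck_on k (\<lambda>p. h (f p)) S"
  using assms(2,3)
proof (induction k arbitrary: h)
  case 0
  then show ?case using assms(4) continuous_on_compose2[of I h S f] by auto
next
  case (Suc k)
  obtain h' where h': "\<And>u. u \<in> I \<Longrightarrow> (h has_real_derivative h' u) (at u within I)"
    "Ck_interval k I h'"
    using Suc.prems(2) by auto
  have f: "f differentiable at p" if "p \<in> S" for p
    using Suc.prems(1) by (intro differentiable_on_openD[OF _ assms(1) that]) simp
  note pd = partial_deriv_compose[OF assms(1) _ f assms(4) h'(1)]
  have "Ck_on k (partial_deriv i (\<lambda>p. h (f p))) S" for i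
  proof (rule Ck_on_cong[OF assms(1)])
    show "Ck_on k (\<lambda>p. h' (f p) * partial_deriv i f p) S"
      using Suc.prems(1)
      by (intro Ck_on_mult[OF assms(1) Suc.IH[OF Ck_on_Suc_D[OF Suc.prems(1)] h'(2)]]) simp
  qed (simp add: pd(2) assms(4))
  moreover have "(\<lambda>p. h (f p)) differentiable_on S"
    using assms(1,4) pd(1) by (auto simp: differentiable_on_eq_differentiable_at)
  ultimately show ?case by simp
qed

text \<open>Both mixed derivatives are limits of the same second difference quotient.\<close>

lemma second_difference_mvt:
  fixes f :: "real ^ 'n \<Rightarrow> real"
  assumes "h > 0"
    and "\<And>s t. 0 \<le> s \<Longrightarrow> s \<le> h \<Longrightarrow> 0 \<le> t \<Longrightarrow> t \<le> h \<Longrightarrow> p + s *\<^sub>R axis i 1 + t *\<^sub>R axis j 1 \<in> S"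
    and "open S" "Ck_on 2 f S"
  obtains s t where "0 < s" "s < h" "0 < t" "t < h"
    "f (p + h *\<^sub>R axis i 1 + h *\<^sub>R axis j 1) - f (p + h *\<^sub>R axis i 1) - f (p + h *\<^sub>R axis j 1) + f p
      = h\<^sup>2 * partial_deriv j (partial_deriv i f) (p + s *\<^sub>R axis i 1 + t *\<^sub>R axis j 1)"
proof -
  let ?e = "axis i 1" and ?d = "axis j 1"
  have fd: "f differentiable at q" "partial_deriv i f differentiable at q" if "q \<in> S" for q
    using assms(3,4) that differentiable_on_openD by (auto simp: numeral_2_eq_2)
  \<comment> \<open>Mean value theorem in direction \<open>i\<close>, for the difference of
    \<open>f\<close> across a step \<open>h\<close> in direction \<open>j\<close>. Then
    \<open>d2\<close> repeats it in direction \<open>j\<close> for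
    \<open>partial_deriv i f\<close>.\<close>
  have d1: "((\<lambda>s. f (p + h *\<^sub>R ?d + s *\<^sub>R ?e) - f (p + s *\<^sub>R ?e)) has_real_derivative
      partial_deriv i f (p + h *\<^sub>R ?d + s *\<^sub>R ?e) - partial_deriv i f (p + s *\<^sub>R ?e)) (at s)"
    if "0 \<le> s" "s \<le> h" for s
    using assms(2)[of s h] assms(2)[of s 0] assms(1) that
    by (intro DERIV_diff partial_deriv_along_line fd) (auto simp: add_ac)
  obtain s where s: "0 < s" "s < h" and
    "(f (p + h *\<^sub>R ?d + h *\<^sub>R ?e) - f (p + h *\<^sub>R ?e)) - (f (p + h *\<^sub>R ?d + 0 *\<^sub>R ?e) - f (p + 0 *\<^sub>R ?e))
      = (h - 0) * (partial_deriv i f (p + h *\<^sub>R ?d + s *\<^sub>R ?e) - partial_deriv i f (p + s *\<^sub>R ?e))"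
    using MVT2[OF assms(1) d1] by blast
  moreover have d2: "((\<lambda>t. partial_deriv i f (p + s *\<^sub>R ?e + t *\<^sub>R ?d)) has_real_derivative
      partial_deriv j (partial_deriv i f) (p + s *\<^sub>R ?e + t *\<^sub>R ?d)) (at t)"
    if "0 \<le> t" "t \<le> h" for t
    using assms(2)[of s t] s that by (intro partial_deriv_along_line fd) auto
  moreover obtain t where "0 < t" "t < h" and
    "partial_deriv i f (p + s *\<^sub>R ?e + h *\<^sub>R ?d) - partial_deriv i f (p + s *\<^sub>R ?e + 0 *\<^sub>R ?d)
      = (h - 0) * partial_deriv j (partial_deriv i f) (p + s *\<^sub>R ?e + t *\<^sub>R ?d)"
    using MVT2[OF assms(1) d2] by blast
  ultimately show thesis
    by (intro that[of s t]) (auto simp: add_ac power2_eq_square algebra_simps)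
qed

lemma partial_deriv_commute:
  fixes f :: "real ^ 'n \<Rightarrow> real"
  assumes "open S" "Ck_on 2 f S" "p \<in> S"
  shows "partial_deriv j (partial_deriv i f) p = partial_deriv i (partial_deriv j f) p"
    (is "?g p = ?h p")
proof (rule ccontr)
  assume "?g p \<noteq> ?h p"
  then have e: "0 < \<bar>?g p - ?h p\<bar> / 2" (is "0 < ?e") by simp
  have cont: "continuous_on S ?g" "continuous_on S ?h"
    using assms(2) by (auto simp: numeral_2_eq_2)
  obtain d1 where d1: "d1 > 0" "\<And>q. q \<in> S \<Longrightarrow> dist q p < d1 \<Longrightarrow> dist (?g q) (?g p) < ?e"
    using cont(1) e assms(3) unfolding continuous_on_iff by meson
  obtain d2 where d2: "d2 > 0" "\<And>q. q \<in> S \<Longrightarrow> dist q p < d2 \<Longrightarrow> dist (?h q) (?h p) < ?e"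
    using cont(2) e assms(3) unfolding continuous_on_iff by meson
  obtain d3 where d3: "d3 > 0" "ball p d3 \<subseteq> S"
    using assms(1,3) openE by blast
  \<comment> \<open>Two steps of length at most \<open>h\<close> stay within \<open>2 * h\<close> of
    \<open>p\<close>; the divisor 3 keeps this strictly below all three radii.\<close>
  define h where "h = min d1 (min d2 d3) / 3"
  have h: "h > 0" "2 * h < d1" "2 * h < d2" "2 * h < d3"
    using d1(1) d2(1) d3(1) by (auto simp: h_def min_def)
  have near: "dist (p + s *\<^sub>R axis k 1 + t *\<^sub>R axis l 1) p \<le> 2 * h"
    if "0 \<le> s" "s \<le> h" "0 \<le> t" "t \<le> h" for s t and k l :: 'n
  proof -
    have "norm (s *\<^sub>R axis k 1 + t *\<^sub>R axis l (1::real)) \<le> \<bar>s\<bar> + \<bar>t\<bar>"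
      by (rule norm_triangle_le) (simp add: norm_axis_1)
    then show ?thesis using that by (simp add: dist_norm add.assoc)
  qed
  have inS: "p + s *\<^sub>R axis k 1 + t *\<^sub>R axis l 1 \<in> S"
    if "0 \<le> s" "s \<le> h" "0 \<le> t" "t \<le> h" for s t and k l :: 'n
  proof -
    have "p + s *\<^sub>R axis k 1 + t *\<^sub>R axis l 1 \<in> ball p d3"
      using order_le_less_trans[OF near[OF that, of k l] h(4)]
      unfolding mem_ball by (subst dist_commute)
    with d3(2) show ?thesis ..
  qed
  obtain s t where st: "0 < s" "s < h" "0 < t" "t < h"
    "f (p + h *\<^sub>R axis i 1 + h *\<^sub>R axis j 1) - f (p + h *\<^sub>R axis i 1) - f (p + h *\<^sub>R axis j 1) + f p
      = h\<^sup>2 * ?g (p + s *\<^sub>R axis i 1 + t *\<^sub>R axis j 1)"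
    by (rule second_difference_mvt[OF h(1) _ assms(1,2)]) (use inS in blast)+
  obtain s' t' where st': "0 < s'" "s' < h" "0 < t'" "t' < h"
    "f (p + h *\<^sub>R axis j 1 + h *\<^sub>R axis i 1) - f (p + h *\<^sub>R axis j 1) - f (p + h *\<^sub>R axis i 1) + f p
      = h\<^sup>2 * ?h (p + s' *\<^sub>R axis j 1 + t' *\<^sub>R axis i 1)"
    by (rule second_difference_mvt[OF h(1) _ assms(1,2)]) (use inS in blast)+
  let ?q = "p + s *\<^sub>R axis i 1 + t *\<^sub>R axis j 1" and ?r = "p + s' *\<^sub>R axis j 1 + t' *\<^sub>R axis i 1"
  \<comment> \<open>The second difference is symmetric in \<open>i\<close> and \<open>j\<close>, so
    one mixed derivative at \<open>?q\<close> equals the other at \<open>?r\<close>.\<close>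
  have swap: "p + h *\<^sub>R axis i 1 + h *\<^sub>R axis j 1 = p + h *\<^sub>R axis j 1 + h *\<^sub>R axis i 1"
    by (simp add: add_ac)
  have "h\<^sup>2 * ?g ?q = h\<^sup>2 * ?h ?r"
    using st(5) st'(5) unfolding swap by linarith
  then have "?g ?q = ?h ?r" using h(1) by simp
  moreover have "dist (?g ?q) (?g p) < ?e"
    using st near[of s t i j] h(2) inS[of s t i j] by (intro d1(2)) auto
  moreover have "dist (?h ?r) (?h p) < ?e"
    using st' near[of s' t' j i] h(3) inS[of s' t' j i] by (intro d2(2)) auto
  ultimately have "dist (?g p) (?h p) < \<bar>?g p - ?h p\<bar>"
    using dist_triangle_half_r[of "?g ?q" "?g p" _ "?h p"] by metis
  then show False by (simp add: dist_real_def)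
qed

subsection \<open>Smooth bump functions\<close>

text \<open>Polynomials in 1/t times exp(-1/t), extended by zero to t \<le> 0. The factor
  \<open>P\<close> is carried along to make the family closed under differentiation.\<close>

definition flat :: "real poly \<Rightarrow> real \<Rightarrow> real"
  where "flat P t = (if 0 < t then poly P (inverse t) * exp (- inverse t) else 0)"

text \<open>The free power \<open>x ^ k\<close> makes the induction on the coefficients work:
  splitting off the constant coefficient raises the exponent by one.\<close>

lemma poly_times_exp_tendsto_0: "((\<lambda>x. x ^ k * poly P x / exp x) \<longlongrightarrow> (0::real)) at_top"
proof (induction P arbitrary: k)
  case (pCons a P)
  have "((\<lambda>x. a * (x ^ k / exp x) + x ^ Suc k * poly P x / exp x) \<longlongrightarrow> a * 0 + 0) at_top"
    by (intro tendsto_intros tendsto_power_div_exp_0 pCons.IH)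
  then show ?case
    by (simp add: algebra_simps add_divide_distrib)
qed simp

lemma flat_tendsto_0: "(flat P \<longlongrightarrow> 0) (at 0)"
proof -
  have "((\<lambda>x. poly P x / exp x) \<longlongrightarrow> 0) at_top"
    using poly_times_exp_tendsto_0[of 0 P] by simp
  \<comment> \<open>The substitution x = 1/t turns decay at infinity into decay at 0 from the
    right.\<close>
  then have "((\<lambda>t. poly P (inverse t) / exp (inverse t)) \<longlongrightarrow> 0) (at_right 0)"
    by (rule filterlim_compose[OF _ filterlim_inverse_at_top_right])
  then have "(flat P \<longlongrightarrow> 0) (at_right 0)"
    by (rule Lim_transform_eventually)
       (auto simp: eventually_at_filter flat_def exp_minus divide_inverse)
  moreover have "(flat P \<longlongrightarrow> 0) (at_left 0)"
    by (rule tendsto_eventually) (auto simp: eventually_at_filter flat_def)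
  ultimately show ?thesis
    by (simp add: filterlim_split_at)
qed

text \<open>For t > 0 the derivative of P(1/t) exp(-1/t) is (P(1/t) - P'(1/t)) exp(-1/t) / t^2; the
  polynomial \<open>[:0, 0, 1:]\<close> supplies the factor 1/t^2.\<close>

lemma flat_has_derivative:
  "(flat P has_real_derivative flat ([:0, 0, 1:] * (P - pderiv P)) t) (at t)"
proof (cases t "0::real" rule: linorder_cases)
  case less
  have "((\<lambda>_. 0) has_real_derivative 0) (at t)" by simp
  then have "(flat P has_real_derivative 0) (at t)"
    by (rule has_field_derivative_transform_within_open[of _ _ _ "{..<0}"])
       (use less in \<open>auto simp: flat_def\<close>)
  with less show ?thesis by (simp add: flat_def)
next
  case equal
  \<comment> \<open>The difference quotient at 0 belongs to the same family, with \<open>P\<close>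
    multiplied by the variable, and hence tends to 0.\<close>
  have "(flat P s - flat P 0) / (s - 0) = flat ([:0, 1:] * P) s" for s
    by (simp add: flat_def divide_inverse)
  then have "((\<lambda>s. (flat P s - flat P 0) / (s - 0)) \<longlongrightarrow> 0) (at 0)"
    using flat_tendsto_0 by presburger
  with equal show ?thesis by (simp add: has_field_derivative_iff flat_def)
next
  case greater
  have "((\<lambda>t. poly P (inverse t) * exp (- inverse t)) has_real_derivative
      flat ([:0, 0, 1:] * (P - pderiv P)) t) (at t)"
    using greater
    by (auto intro!: derivative_eq_intros DERIV_chain2[of "poly P"]
        simp: flat_def power2_eq_square algebra_simps)
  then show ?thesis
    by (rule has_field_derivative_transform_within_open[of _ _ _ "{0<..}"])
       (use greater in \<open>auto simp: flat_def\<close>)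
qed

lemma Ck_interval_flat: "Ck_interval k UNIV (flat P)"
proof (induction k arbitrary: P)
  case 0
  then show ?case
    using flat_has_derivative by (auto intro!: continuous_at_imp_continuous_on DERIV_isCont)
next
  case (Suc k)
  then show ?case using flat_has_derivative by auto
qed

text \<open>The function is \<open>flat 1\<close> composed with r^2 - |p - a|^2, which is positive
  exactly on the open ball.\<close>

lemma exists_bump_function:
  fixes a :: "real ^ 'n"
  assumes "r > 0" "cball a r \<subseteq> \<Omega>"
  obtains \<phi> where "test_function \<Omega> \<phi>" "\<And>p. \<phi> p \<ge> 0" "\<And>p. p \<notin> ball a r \<Longrightarrow> \<phi> p = 0"
    "\<And>p. p \<in> ball a r \<Longrightarrow> \<phi> p > 0"
proof -
  \<comment> \<open>Written with sums, products, coordinates and constants only, so that the closure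
    properties of C^k give smoothness.\<close>
  define q where "q p = r\<^sup>2 + (\<Sum>i\<in>UNIV. (- 1) * ((p $ i + - a $ i) * (p $ i + - a $ i)))" for p
  have q: "q p = r\<^sup>2 - (norm (p - a))\<^sup>2" for p
    by (simp add: q_def norm_vec_def L2_set_def sum_nonneg sum_negf power2_eq_square)
  have pos: "q p > 0 \<longleftrightarrow> p \<in> ball a r" for p
    using assms(1) abs_le_square_iff[of r "norm (p - a)"]
    by (auto simp: q dist_norm norm_minus_commute simp flip: not_le)
  let ?\<phi> = "\<lambda>p. flat 1 (q p)"
  have "Ck_on k q UNIV" for k
    unfolding q_def
    by (intro Ck_on_add Ck_on_sum Ck_on_mult Ck_on_const Ck_on_vec_nth_id) auto
  then have "Ck_on k ?\<phi> UNIV" for k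
    by (rule Ck_on_compose[OF open_UNIV _ Ck_interval_flat]) auto
  moreover have sub: "closure (support_on UNIV ?\<phi>) \<subseteq> cball a r"
    by (rule closure_minimal) (use pos in \<open>auto simp: support_on_def flat_def split: if_splits\<close>)
  moreover have "compact (closure (support_on UNIV ?\<phi>))"
    using sub bounded_subset[OF bounded_cball] by (simp add: compact_eq_bounded_closed)
  ultimately have "test_function \<Omega> ?\<phi>"
    using assms(2) by (auto simp: test_function_def)
  with pos show thesis
    by (intro that[of ?\<phi>]) (auto simp: flat_def)
qed

subsection \<open>Integration by parts and the fundamental lemma\<close>

text \<open>By translation invariance of Lebesgue measure the difference quotients of
  \<open>h\<close> have integral zero. They converge to the partial derivative and are dominated by
  a constant on a ball.\<close>

lemma integral_partial_deriv_0:
  fixes h :: "real ^ 'n \<Rightarrow> real"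
  assumes "Ck_on 1 h UNIV" "compact K" "\<And>p. p \<notin> K \<Longrightarrow> h p = 0"
  shows "(\<integral>p. partial_deriv i h p \<partial>lborel) = 0"
proof -
  let ?e = "axis i 1 :: real ^ 'n"
  have diff: "h differentiable at p" for p
    using assms(1) by (simp add: differentiable_on_eq_differentiable_at)
  have conth: "continuous_on UNIV h" and contd: "continuous_on UNIV (partial_deriv i h)"
    using assms(1) by (auto simp: differentiable_imp_continuous_on)
  have d0: "partial_deriv i h p = 0" if "p \<notin> K" for p
    using partial_deriv_cong[of "- K" p h "\<lambda>_. 0" i] that assms(2,3) by (simp add: compact_imp_closed open_Compl)
  have "integrable lborel (\<lambda>p. indicator K p *\<^sub>R h p)"
    using assms(2) conth by (intro borel_integrable_compact) (auto intro: continuous_on_subset)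
  moreover have "(\<lambda>p. indicator K p *\<^sub>R h p) = h"
    using assms(3) by (auto simp: indicator_def fun_eq_iff)
  ultimately have inth: "integrable lborel h" by simp
  have meas: "h \<in> borel_measurable borel" "partial_deriv i h \<in> borel_measurable borel"
    using conth contd by (auto intro: borel_measurable_continuous_onI)
  have shift: "integrable lborel (\<lambda>p. h (c + p))" "(\<integral>p. h (c + p) \<partial>lborel) = (\<integral>p. h p \<partial>lborel)" for c
    using integrable_distr_eq[of "(+) c" lborel borel h] integral_distr[of "(+) c" lborel borel h]
      inth meas by (auto simp: lborel_distr_plus)
  have "compact (partial_deriv i h ` K)"
    using assms(2) contd by (intro compact_continuous_image) (auto intro: continuous_on_subset)
  then obtain M where M: "\<And>p. p \<in> K \<Longrightarrow> \<bar>partial_deriv i h p\<bar> \<le> M"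
    using compact_imp_bounded[of "partial_deriv i h ` K"] by (auto simp: bounded_iff)
  \<comment> \<open>The absolute value covers the case of an empty \<open>K\<close>, where
    \<open>M\<close> may be negative.\<close>
  have bound: "\<bar>partial_deriv i h p\<bar> \<le> \<bar>M\<bar>" for p
    using M[of p] d0[of p] by (cases "p \<in> K") auto
  obtain R where R: "\<And>p. p \<in> K \<Longrightarrow> norm p \<le> R"
    using compact_imp_bounded[OF assms(2)] by (auto simp: bounded_iff)
  define s where "s n = inverse (real (Suc n))" for n
  have s: "0 < s n" "s n \<le> 1" for n
    by (simp_all add: s_def inverse_le_1_iff)
  define D where "D n p = (h (s n *\<^sub>R ?e + p) - h p) / s n" for n p
  have "(\<lambda>n. \<integral>p. D n p \<partial>lborel) \<longlonglongrightarrow> (\<integral>p. partial_deriv i h p \<partial>lborel)"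
  proof (rule integral_dominated_convergence)
    \<comment> \<open>Steps of length at most 1 move the support by at most 1, so every difference
      quotient vanishes outside the ball of radius \<open>R + 1\<close>. Inside, the mean value
      theorem bounds it by the derivative.\<close>
    show "integrable lborel (\<lambda>p::real^'n. indicator (cball 0 (R + 1)) p *\<^sub>R \<bar>M\<bar>)"
      by (intro borel_integrable_compact) auto
    show "AE p in lborel. (\<lambda>n. D n p) \<longlonglongrightarrow> partial_deriv i h p"
    proof (rule AE_I2)
      fix p
      have "((\<lambda>t. (h (p + t *\<^sub>R ?e) - h (p + 0 *\<^sub>R ?e)) / (t - 0)) \<longlongrightarrow> partial_deriv i h (p + 0 *\<^sub>R ?e)) (at 0)"
        using partial_deriv_along_line[of h p 0 i] diff by (simp add: has_field_derivative_iff)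
      moreover have "filterlim s (at 0) sequentially"
      proof (rule filterlim_atI)
        show "s \<longlonglongrightarrow> 0" unfolding s_def by (rule LIMSEQ_inverse_real_of_nat)
      qed (use s in \<open>auto simp: less_imp_neq[symmetric]\<close>)
      ultimately show "(\<lambda>n. D n p) \<longlonglongrightarrow> partial_deriv i h p"
        unfolding D_def using filterlim_compose by (fastforce simp: add.commute)
    qed
    show "AE p in lborel. norm (D n p) \<le> indicator (cball 0 (R + 1)) p *\<^sub>R \<bar>M\<bar>" for n
    proof (rule AE_I2)
      fix p
      have "((\<lambda>t. h (p + t *\<^sub>R ?e)) has_real_derivative partial_deriv i h (p + t *\<^sub>R ?e)) (at t)" for t
        using diff by (rule partial_deriv_along_line)
      from MVT2[OF s(1)[of n] this]
      obtain t where "h (p + s n *\<^sub>R ?e) - h (p + 0 *\<^sub>R ?e) = (s n - 0) * partial_deriv i h (p + t *\<^sub>R ?e)"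
        by auto
      then have "D n p = partial_deriv i h (p + t *\<^sub>R ?e)"
        using s(1)[of n] by (simp add: D_def add.commute field_simps)
      then have "\<bar>D n p\<bar> \<le> \<bar>M\<bar>" using bound by simp
      moreover have "D n p = 0" if "norm p > R + 1"
      proof -
        have "norm p \<le> norm (s n *\<^sub>R ?e + p) + norm (s n *\<^sub>R ?e)"
          by (metis add_diff_cancel_left' norm_triangle_ineq4 add.commute)
        also have "norm (s n *\<^sub>R ?e) \<le> 1" using s[of n] by (simp add: norm_axis_1)
        finally have "s n *\<^sub>R ?e + p \<notin> K" "p \<notin> K" using that R by fastforce+
        then show ?thesis using assms(3) by (simp add: D_def)
      qed
      ultimately show "norm (D n p) \<le> indicator (cball 0 (R + 1)) p *\<^sub>R \<bar>M\<bar>"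
        by (auto simp: indicator_def)
    qed
    show "partial_deriv i h \<in> borel_measurable lborel" using meas by simp
    show "D n \<in> borel_measurable lborel" for n
      unfolding D_def using meas by simp
  qed
  moreover have "(\<integral>p. D n p \<partial>lborel) = 0" for n
    using shift[of "s n *\<^sub>R ?e"] inth by (simp add: D_def)
  ultimately show ?thesis
    by (simp add: LIMSEQ_const_iff)
qed

lemma test_functionD:
  assumes "test_function \<Omega> \<phi>"
  obtains K where "compact K" "K \<subseteq> \<Omega>" "\<And>p. p \<notin> K \<Longrightarrow> \<phi> p = 0"
    "\<And>p i. p \<notin> K \<Longrightarrow> partial_deriv i \<phi> p = 0"
proof
  let ?K = "closure (support_on UNIV \<phi>)"
  show "compact ?K" "?K \<subseteq> \<Omega>" using assms by (auto simp: test_function_def)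
  show 0: "\<phi> p = 0" if "p \<notin> ?K" for p
    using that closure_subset[of "support_on UNIV \<phi>"] by (auto simp: support_on_def)
  show "partial_deriv i \<phi> p = 0" if "p \<notin> ?K" for p i
    using partial_deriv_cong[of "- ?K" p \<phi> "\<lambda>_. 0" i] 0 that by (simp add: open_Compl)
qed

text \<open>Although \<open>u\<close> may be unbounded near the boundary of \<Omega>, the product
  lives on the compact set \<open>K\<close>, where both factors are continuous.\<close>

lemma set_integrable_compact_support:
  fixes u v :: "real ^ 'n \<Rightarrow> real"
  assumes "continuous_on \<Omega> u" "continuous_on UNIV v" "compact K" "K \<subseteq> \<Omega>"
    "\<And>p. p \<notin> K \<Longrightarrow> v p = 0"
  shows "set_integrable lborel \<Omega> (\<lambda>p. u p * v p)"
proof -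
  have "integrable lborel (\<lambda>p. indicator K p *\<^sub>R (u p * v p))"
    using assms by (intro borel_integrable_compact continuous_on_mult) (auto intro: continuous_on_subset)
  moreover have "(\<lambda>p. indicator K p *\<^sub>R (u p * v p)) = (\<lambda>p. indicator \<Omega> p *\<^sub>R (u p * v p))"
    using assms(4,5) by (auto simp: indicator_def fun_eq_iff)
  ultimately show ?thesis by (simp add: set_integrable_def)
qed

lemma set_integrable_test:
  fixes u :: "real ^ 'n \<Rightarrow> real"
  assumes "continuous_on \<Omega> u" "test_function \<Omega> \<phi>"
  shows "set_integrable lborel \<Omega> (\<lambda>p. u p * \<phi> p)"
    and "set_integrable lborel \<Omega> (\<lambda>p. u p * partial_deriv i \<phi> p)"
proof -
  obtain K where K: "compact K" "K \<subseteq> \<Omega>" "\<And>p. p \<notin> K \<Longrightarrow> \<phi> p = 0"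
    "\<And>p i. p \<notin> K \<Longrightarrow> partial_deriv i \<phi> p = 0"
    using test_functionD[OF assms(2)] by metis
  have "Ck_on 0 \<phi> UNIV" "Ck_on (Suc 0) \<phi> UNIV"
    using assms(2) unfolding test_function_def by blast+
  then have "continuous_on UNIV \<phi>" "continuous_on UNIV (partial_deriv i \<phi>)"
    by auto
  with K show "set_integrable lborel \<Omega> (\<lambda>p. u p * \<phi> p)"
    "set_integrable lborel \<Omega> (\<lambda>p. u p * partial_deriv i \<phi> p)"
    by (auto intro!: set_integrable_compact_support[OF assms(1)])
qed

text \<open>The product of \<open>u\<close> and \<phi>, extended by zero, is C^1 on the whole space
  with compact support, so its partial derivative integrates to zero.\<close>

lemma integration_by_parts:
  fixes u :: "real ^ 'n \<Rightarrow> real"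
  assumes "open \<Omega>" "Ck_on 1 u \<Omega>" "test_function \<Omega> \<phi>"
  shows "(LINT p:\<Omega>|lborel. u p * partial_deriv i \<phi> p) = - (LINT p:\<Omega>|lborel. partial_deriv i u p * \<phi> p)"
proof -
  obtain K where K: "compact K" "K \<subseteq> \<Omega>" "\<And>p. p \<notin> K \<Longrightarrow> \<phi> p = 0"
    using test_functionD[OF assms(3)] by metis
  define h where "h p = (if p \<in> \<Omega> then u p * \<phi> p else 0)" for p
  have \<phi>: "Ck_on 1 \<phi> UNIV"
    using assms(3) unfolding test_function_def by blast
  have "Ck_on 1 h \<Omega>"
    by (rule Ck_on_cong[OF assms(1) _ Ck_on_mult[OF assms(1,2) Ck_on_subset[OF \<phi>]]]) (auto simp: h_def)
  moreover have oK: "open (- K)" using K(1) by (simp add: compact_imp_closed open_Compl)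
  moreover have "Ck_on 1 h (- K)"
    by (rule Ck_on_cong[OF oK _ Ck_on_const[of 1 0]]) (use K(3) in \<open>auto simp: h_def\<close>)
  \<comment> \<open>The open sets \<Omega> and \<open>- K\<close> cover the space; \<open>h\<close>
    is the product on the first and zero on the second.\<close>
  ultimately have "Ck_on 1 h (\<Omega> \<union> - K)"
    using assms(1) by (intro Ck_on_open_Un)
  moreover have "\<Omega> \<union> - K = UNIV" using K(2) by blast
  ultimately have hC: "Ck_on 1 h UNIV" by simp
  have h0: "h p = 0" if "p \<notin> K" for p using K(3) that by (simp add: h_def)
  have pd: "partial_deriv i h p = indicator \<Omega> p *\<^sub>R (partial_deriv i u p * \<phi> p + u p * partial_deriv i \<phi> p)" for p
  proof (cases "p \<in> \<Omega>")
    case True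
    have "u differentiable at p" "\<phi> differentiable at p"
      using assms(2) \<phi> True by (auto intro: differentiable_on_openD[OF _ assms(1)] differentiable_on_openD[of _ UNIV])
    then show ?thesis
      using True partial_deriv_cong[OF assms(1) True, of h "\<lambda>p. u p * \<phi> p" i]
      by (simp add: h_def partial_deriv_mult)
  next
    case False
    then show ?thesis
      using partial_deriv_cong[OF oK, of p h "\<lambda>_. 0" i] h0 K(2) by auto
  qed
  have "0 = (LINT p:\<Omega>|lborel. partial_deriv i u p * \<phi> p + u p * partial_deriv i \<phi> p)"
    using integral_partial_deriv_0[OF hC K(1) h0, of i] by (simp add: pd set_lebesgue_integral_def)
  also have "\<dots> = (LINT p:\<Omega>|lborel. partial_deriv i u p * \<phi> p) + (LINT p:\<Omega>|lborel. u p * partial_deriv i \<phi> p)"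
    using assms(2) by (intro set_integral_add set_integrable_test assms(3)) (auto simp: differentiable_imp_continuous_on)
  finally show ?thesis by simp
qed

text \<open>Otherwise a bump function on a ball where \<open>u\<close> keeps its sign would give an
  integrand of one sign with integral zero, and the ball would be a null set.\<close>

lemma fundamental_lemma_calculus_of_variations:
  fixes u :: "real ^ 'n \<Rightarrow> real"
  assumes "open \<Omega>" "continuous_on \<Omega> u" "a \<in> \<Omega>"
    and "\<And>\<phi>. test_function \<Omega> \<phi> \<Longrightarrow> (LINT p:\<Omega>|lborel. u p * \<phi> p) = 0"
  shows "u a = 0"
proof (rule ccontr)
  assume "u a \<noteq> 0"
  \<comment> \<open>The sign factor makes \<open>v a\<close> positive, so that both signs of
    \<open>u a\<close> are treated at once.\<close>
  define v where "v p = sgn (u a) * u p" for p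
  have v: "continuous_on \<Omega> v" "v a > 0"
    using assms(2) \<open>u a \<noteq> 0\<close> by (auto simp: v_def intro!: continuous_intros) (metis abs_sgn mult.commute zero_less_abs_iff)
  obtain d where d: "d > 0" "\<And>p. p \<in> \<Omega> \<Longrightarrow> dist p a < d \<Longrightarrow> dist (v p) (v a) < v a"
    using v assms(3) unfolding continuous_on_iff by meson
  obtain e where e: "e > 0" "cball a e \<subseteq> \<Omega>"
    using assms(1,3) open_contains_cball by blast
  define r where "r = min d e / 2"
  have r: "r > 0" "r < d" "cball a r \<subseteq> \<Omega>"
    using d(1) e by (auto simp: r_def)
  have vpos: "v p > 0" if "p \<in> ball a r" for p
    using d(2)[of p] that r by (auto simp: dist_real_def dist_commute subset_iff)
  obtain \<phi> where \<phi>: "test_function \<Omega> \<phi>" "\<And>p. \<phi> p \<ge> 0" "\<And>p. p \<notin> ball a r \<Longrightarrow> \<phi> p = 0"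
    "\<And>p. p \<in> ball a r \<Longrightarrow> \<phi> p > 0"
    using exists_bump_function[OF r(1,3)] by metis
  let ?g = "\<lambda>p. indicator \<Omega> p *\<^sub>R (v p * \<phi> p)"
  have "(\<integral>p. ?g p \<partial>lborel) = sgn (u a) * (LINT p:\<Omega>|lborel. u p * \<phi> p)"
    unfolding set_lebesgue_integral_def v_def
    by (subst integral_mult_right_zero[symmetric]) (simp add: mult_ac)
  then have "(\<integral>p. ?g p \<partial>lborel) = 0"
    using assms(4)[OF \<phi>(1)] by simp
  moreover have "integrable lborel ?g"
    using set_integrable_test(1)[OF v(1) \<phi>(1)] by (simp add: set_integrable_def)
  moreover have "?g p \<ge> 0" for p
    using \<phi>(2,3)[of p] vpos[of p] by (cases "p \<in> ball a r") (auto simp: indicator_def)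
  ultimately have "AE p in lborel. ?g p = 0"
    using integral_nonneg_eq_0_iff_AE[of lborel ?g] by simp
  moreover have "?g p \<noteq> 0" if "p \<in> ball a r" for p
    using \<phi>(4)[OF that] vpos[OF that] that r(3) by (auto simp: indicator_def)
  ultimately have "AE p in lborel. p \<notin> ball a r"
    by (auto elim!: eventually_mono)
  then have "emeasure lborel (ball a r) = 0"
    by (subst (asm) AE_iff_measurable[where N="ball a r"]) auto
  then show False
    using r(1) content_ball_pos[of r a] by (simp add: measure_def)
qed

subsection \<open>Harmonic functions\<close>

definition laplacian :: "(real ^ 'n \<Rightarrow> real) \<Rightarrow> real ^ 'n \<Rightarrow> real"
  where "laplacian w p = (\<Sum>i\<in>UNIV. partial_deriv i (partial_deriv i w) p)"

lemma Ck_on_2D: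
  assumes "open S" "Ck_on 2 w S"
  shows "Ck_on 1 (partial_deriv i w) S" "continuous_on S (partial_deriv i w)"
    "continuous_on S (partial_deriv j (partial_deriv i w))" "continuous_on S w"
    and "p \<in> S \<Longrightarrow> w differentiable at p" "p \<in> S \<Longrightarrow> partial_deriv i w differentiable at p"
  using assms by (auto simp: numeral_2_eq_2 differentiable_on_eq_differentiable_at
      intro: differentiable_imp_continuous_on)

text \<open>At a maximum \<open>h' 0 = 0\<close>. If \<open>c\<close> were positive,
  \<open>h'\<close> would be positive just to the right of 0 and \<open>h\<close> would exceed
  \<open>h 0\<close> there.\<close>

lemma second_derivative_local_max:
  fixes h h' :: "real \<Rightarrow> real"
  assumes "e > 0" "\<And>t. \<bar>t\<bar> < e \<Longrightarrow> (h has_real_derivative h' t) (at t)"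
    and "(h' has_real_derivative c) (at 0)" "\<And>t. \<bar>t\<bar> < e \<Longrightarrow> h t \<le> h 0"
  shows "c \<le> 0"
proof (rule ccontr)
  assume "\<not> c \<le> 0"
  then obtain d where d: "d > 0" "\<And>t. 0 < t \<Longrightarrow> t < d \<Longrightarrow> h' 0 < h' (0 + t)"
    using has_real_derivative_pos_inc_right[OF assms(3)] by auto
  have "h' 0 = 0"
    using assms(1,2,4) by (intro DERIV_local_max[of h "h' 0" 0 e]) auto
  define t where "t = min e d / 2"
  have t: "0 < t" "t < e" "t < d" using assms(1) d(1) by (auto simp: t_def)
  have D: "(h has_real_derivative h' s) (at s)" if "0 \<le> s" "s \<le> t" for s
    using that t by (intro assms(2)) auto
  obtain s where s: "0 < s" "s < t" "h t - h 0 = (t - 0) * h' s"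
    using MVT2[OF t(1) D] by auto
  then have "h' s > 0" using d(2)[of s] \<open>h' 0 = 0\<close> t by auto
  then have "h t > h 0" using s(3) mult_pos_pos[OF t(1)] by fastforce
  with assms(4)[of t] t show False by auto
qed

text \<open>Adding \<open>\<epsilon> \<bar>p\<bar>\<^sup>2\<close> makes the Laplacian positive, which excludes an interior maximum.\<close>

lemma weak_maximum_principle:
  fixes w :: "real ^ 'n \<Rightarrow> real"
  assumes "open \<Omega>" "bounded \<Omega>" "Ck_on 2 w \<Omega>" "continuous_on (closure \<Omega>) w"
    and "\<And>p. p \<in> \<Omega> \<Longrightarrow> laplacian w p = 0" "\<And>p. p \<in> frontier \<Omega> \<Longrightarrow> w p \<le> 0"
    and "p \<in> closure \<Omega>"
  shows "w p \<le> 0"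
proof (rule ccontr)
  assume "\<not> w p \<le> 0"
  then have pos: "w p > 0" by simp
  have comp: "compact (closure \<Omega>)" using assms(2) by simp
  obtain R where R: "\<And>q. q \<in> closure \<Omega> \<Longrightarrow> norm q \<le> R"
    using compact_imp_bounded[OF comp] by (auto simp: bounded_iff)
  \<comment> \<open>Chosen so that \<open>e * R\<^sup>2\<close> is below \<open>w p\<close>: the
    perturbation then cannot move the maximum to the frontier. The summand 1 keeps the denominator
    positive.\<close>
  define e where "e = w p / (R\<^sup>2 + 1)"
  have R1: "R\<^sup>2 + 1 > 0" by (simp add: add_nonneg_pos)
  have e: "e > 0" using pos R1 by (simp add: e_def)
  have eR: "e * R\<^sup>2 < w p"
    using e R1 by (simp add: e_def field_simps pos)
  define v where "v q = w q + e * (norm q)\<^sup>2" for q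
  have v: "continuous_on (closure \<Omega>) v"
    unfolding v_def by (intro continuous_intros assms(4))
  have "closure \<Omega> \<noteq> {}" using assms(7) by auto
  from continuous_attains_sup[OF comp this v]
  obtain q where q: "q \<in> closure \<Omega>" "\<And>x. x \<in> closure \<Omega> \<Longrightarrow> v x \<le> v q"
    by auto
  have "0 \<le> e * (norm p)\<^sup>2" using e by simp
  then have "w p \<le> v q"
    using q(2)[OF assms(7)] unfolding v_def[of p] by linarith
  \<comment> \<open>On the frontier \<open>v\<close> is at most \<open>e * R\<^sup>2\<close>, hence
    below \<open>w p\<close> and below the maximum \<open>v q\<close>.\<close>
  have "q \<in> \<Omega>"
  proof (rule ccontr)
    assume "q \<notin> \<Omega>"
    then have "w q \<le> 0" using assms(1,6) q(1) by (simp add: frontier_def interior_open)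
    moreover have "e * (norm q)\<^sup>2 \<le> e * R\<^sup>2"
      using e R[OF q(1)] by (intro mult_left_mono power_mono) auto
    ultimately show False using \<open>w p \<le> v q\<close> eR by (simp add: v_def)
  qed
  then obtain d where d: "d > 0" "ball q d \<subseteq> \<Omega>"
    using assms(1) openE by blast
  have "partial_deriv i (partial_deriv i w) q + 2 * e \<le> 0" for i
  proof (rule second_derivative_local_max[OF d(1)])
    let ?x = "\<lambda>t. q + t *\<^sub>R axis i 1"
    have x: "?x t \<in> \<Omega>" if "\<bar>t\<bar> < d" for t
      using that d(2) by (auto simp: dist_norm norm_axis_1 subset_iff)
    have nrm: "(norm (?x t))\<^sup>2 = (norm q)\<^sup>2 + 2 * t * q $ i + t\<^sup>2" for t
      unfolding power2_norm_eq_inner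
      by (simp add: inner_simps inner_axis inner_axis_axis inner_commute[of "axis i 1"]
          power2_eq_square[of t] algebra_simps)
    show "((\<lambda>t. v (?x t)) has_real_derivative partial_deriv i w (?x t) + e * (2 * q $ i + 2 * t)) (at t)"
      if "\<bar>t\<bar> < d" for t
      unfolding v_def nrm
      by (rule DERIV_add[OF partial_deriv_along_line[OF Ck_on_2D(5)[OF assms(1,3) x[OF that]]]])
         (auto intro!: derivative_eq_intros)
    show "((\<lambda>t. partial_deriv i w (?x t) + e * (2 * q $ i + 2 * t)) has_real_derivative
        partial_deriv i (partial_deriv i w) q + 2 * e) (at 0)"
      using partial_deriv_along_line[of "partial_deriv i w" q 0 i] Ck_on_2D(6)[OF assms(1,3) \<open>q \<in> \<Omega>\<close>]
      by (intro DERIV_add) (auto intro!: derivative_eq_intros)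
    show "v (?x t) \<le> v (?x 0)" if "\<bar>t\<bar> < d" for t
      using q(2)[of "?x t"] x[OF that] closure_subset by auto
  qed
  \<comment> \<open>Summed over the axes, the second derivatives of \<open>w\<close> contribute its
    Laplacian, which is zero; what remains is a positive multiple of \<open>e\<close>.\<close>
  then have "(\<Sum>i\<in>(UNIV::'n set). partial_deriv i (partial_deriv i w) q + 2 * e) \<le> 0"
    by (intro sum_nonpos) auto
  then have "2 * real CARD('n) * e \<le> 0"
    using assms(5)[OF \<open>q \<in> \<Omega>\<close>] by (simp add: sum.distrib laplacian_def)
  with e show False by (simp add: mult_le_0_iff)
qed

section \<open>From criticality to harmonicity\<close>

lemma set_integral_sum:
  fixes u :: "'i \<Rightarrow> 'a \<Rightarrow> real"
  assumes "finite J" "\<And>j. j \<in> J \<Longrightarrow> set_integrable M A (u j)"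
  shows "(LINT p:A|M. \<Sum>j\<in>J. u j p) = (\<Sum>j\<in>J. LINT p:A|M. u j p)"
    and "set_integrable M A (\<lambda>p. \<Sum>j\<in>J. u j p)"
  using assms unfolding set_lebesgue_integral_def set_integrable_def scaleR_sum_right
  by (simp_all only: Bochner_Integration.integral_sum Bochner_Integration.integrable_sum)

text \<open>Two integrations by parts turn criticality into \<open>\<Delta>w \<nabla>w = 0\<close>. Where \<open>\<Delta>w \<noteq> 0\<close>, the function
  \<open>w\<close> would be locally constant.\<close>

lemma critical_imp_harmonic:
  fixes w :: "real ^ 'n \<Rightarrow> real"
  assumes "open \<Omega>" "Ck_on 2 w \<Omega>" "p \<in> \<Omega>"
    and crit: "\<And>\<phi> \<gamma>. test_function \<Omega> \<phi> \<Longrightarrow>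
      (LINT p:\<Omega>|lborel. (\<Sum>\<alpha>\<in>UNIV. (partial_deriv \<alpha> w p)\<^sup>2) * partial_deriv \<gamma> \<phi> p
        - 2 * (\<Sum>\<beta>\<in>UNIV. partial_deriv \<beta> w p * partial_deriv \<gamma> w p * partial_deriv \<beta> \<phi> p)) = 0"
  shows "laplacian w p = 0"
proof -
  note w = Ck_on_2D[OF assms(1,2)]
  have contL: "continuous_on \<Omega> (laplacian w)"
    unfolding laplacian_def using w(3) by (intro continuous_on_sum)
  have prod0: "laplacian w q * partial_deriv \<gamma> w q = 0" if "q \<in> \<Omega>" for q \<gamma>
  proof -
    \<comment> \<open>\<open>A\<close> is the squared length of the gradient. Together,
      \<open>A\<close> and \<open>B\<close> form the row of the stress-energy tensor of
      \<open>w\<close> that belongs to the direction \<gamma>.\<close>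
    define A where "A q = (\<Sum>\<alpha>\<in>UNIV. partial_deriv \<alpha> w q * partial_deriv \<alpha> w q)" for q
    define B where "B \<beta> q = partial_deriv \<beta> w q * partial_deriv \<gamma> w q" for \<beta> q
    have A1: "Ck_on 1 A \<Omega>" and B1: "Ck_on 1 (B \<beta>) \<Omega>" for \<beta>
      unfolding A_def B_def by (intro Ck_on_sum Ck_on_mult assms(1) w(1) finite)+
    then have contA: "continuous_on \<Omega> A" "continuous_on \<Omega> (partial_deriv \<gamma> A)"
      and contB: "continuous_on \<Omega> (B \<beta>)" "continuous_on \<Omega> (partial_deriv \<beta> (B \<beta>))" for \<beta>
      by (auto simp: differentiable_imp_continuous_on)
    \<comment> \<open>Since second derivatives commute, both formulas contain the same mixed terms.
      They cancel in \<open>ptw\<close>, and only the Laplacian times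
      \<open>partial_deriv \<gamma> w\<close> survives.\<close>
    have pdA: "partial_deriv \<gamma> A q = 2 * (\<Sum>\<beta>\<in>UNIV. partial_deriv \<beta> w q * partial_deriv \<gamma> (partial_deriv \<beta> w) q)"
      and pdB: "partial_deriv \<beta> (B \<beta>) q = partial_deriv \<beta> (partial_deriv \<beta> w) q * partial_deriv \<gamma> w q
          + partial_deriv \<beta> w q * partial_deriv \<gamma> (partial_deriv \<beta> w) q"
      if "q \<in> \<Omega>" for q \<beta>
      unfolding A_def B_def using w(6)[OF that] partial_deriv_commute[OF assms(1,2) that]
      by (simp_all add: partial_deriv_sum partial_deriv_mult sum_distrib_left algebra_simps)
    have "2 * (laplacian w q * partial_deriv \<gamma> w q) = 0"
    proof (rule fundamental_lemma_calculus_of_variations[OF assms(1) _ that,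
          of "\<lambda>q. 2 * (laplacian w q * partial_deriv \<gamma> w q)"])
      show "continuous_on \<Omega> (\<lambda>q. 2 * (laplacian w q * partial_deriv \<gamma> w q))"
        by (intro continuous_intros contL w(2))
      fix \<phi> :: "real ^ 'n \<Rightarrow> real" assume \<phi>: "test_function \<Omega> \<phi>"
      note int = set_integrable_test[OF _ \<phi>]
      have ptw: "2 * (laplacian w q * partial_deriv \<gamma> w q) * \<phi> q
          = 2 * (\<Sum>\<beta>\<in>UNIV. partial_deriv \<beta> (B \<beta>) q * \<phi> q) - partial_deriv \<gamma> A q * \<phi> q" if "q \<in> \<Omega>" for q
        unfolding pdA[OF that] pdB[OF that] laplacian_def
        by (simp add: sum.distrib sum_distrib_left sum_distrib_right algebra_simps)
      have "(LINT q:\<Omega>|lborel. 2 * (laplacian w q * partial_deriv \<gamma> w q) * \<phi> q)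
          = (LINT q:\<Omega>|lborel. 2 * (\<Sum>\<beta>\<in>UNIV. partial_deriv \<beta> (B \<beta>) q * \<phi> q) - partial_deriv \<gamma> A q * \<phi> q)"
        using assms(1) ptw by (intro set_lebesgue_integral_cong) auto
      also have "\<dots> = 2 * (\<Sum>\<beta>\<in>UNIV. LINT q:\<Omega>|lborel. partial_deriv \<beta> (B \<beta>) q * \<phi> q)
          - (LINT q:\<Omega>|lborel. partial_deriv \<gamma> A q * \<phi> q)"
        using int(1) contA contB
        by (simp add: set_integral_diff set_integral_sum)
      \<comment> \<open>Integration by parts moves the derivatives onto \<phi>, which brings the
        integral into the form of the criticality hypothesis.\<close>
      also have "\<dots> = (LINT q:\<Omega>|lborel. A q * partial_deriv \<gamma> \<phi> q)
          - 2 * (\<Sum>\<beta>\<in>UNIV. LINT q:\<Omega>|lborel. B \<beta> q * partial_deriv \<beta> \<phi> q)"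
        unfolding integration_by_parts[OF assms(1) A1 \<phi>] integration_by_parts[OF assms(1) B1 \<phi>]
        by (simp add: sum_negf)
      also have "\<dots> = (LINT q:\<Omega>|lborel. A q * partial_deriv \<gamma> \<phi> q
          - 2 * (\<Sum>\<beta>\<in>UNIV. B \<beta> q * partial_deriv \<beta> \<phi> q))"
        using int(2) contA contB
        by (simp add: set_integral_diff set_integral_sum)
      also have "\<dots> = 0"
        using crit[OF \<phi>, of \<gamma>] by (simp add: A_def B_def power2_eq_square)
      finally show "(LINT q:\<Omega>|lborel. 2 * (laplacian w q * partial_deriv \<gamma> w q) * \<phi> q) = 0" .
    qed
    then show ?thesis by simp
  qed
  show ?thesis
  proof (rule ccontr)
    assume nz: "laplacian w p \<noteq> 0"
    \<comment> \<open>Continuity of the Laplacian makes \<open>U\<close> open, so the vanishing of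
      the gradient on \<open>U\<close> can be differentiated at \<open>p\<close>.\<close>
    define U where "U = \<Omega> \<inter> laplacian w -` (- {0})"
    have U: "open U" "p \<in> U"
      unfolding U_def using assms(1,3) contL nz by (auto intro: continuous_open_preimage)
    have "partial_deriv \<beta> w q = 0" if "q \<in> U" for q \<beta>
      using prod0[of q \<beta>] that by (auto simp: U_def)
    then have "partial_deriv \<beta> (partial_deriv \<beta> w) p = 0" for \<beta>
      using partial_deriv_cong[OF U, of "partial_deriv \<beta> w" "\<lambda>_. 0" \<beta>] by simp
    with nz show False by (simp add: laplacian_def)
  qed
qed

subsection \<open>The arc length of a monotone graph\<close>

text \<open>The interval may be unbounded or half-open. The fundamental theorem on compact intervals
  is therefore applied around each point separately, always with the same base point
  \<open>c\<close>.\<close>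

lemma continuous_on_interval_antiderivative:
  fixes s :: "real \<Rightarrow> real"
  assumes "is_interval I" "continuous_on I s"
  obtains F where "\<And>u. u \<in> I \<Longrightarrow> (F has_real_derivative s u) (at u within I)"
proof (cases "I = {}")
  case False
  then obtain c where c: "c \<in> I" by blast
  have "((\<lambda>u. LBINT y=c..u. s y) has_real_derivative s u) (at u within I)" if u: "u \<in> I" for u
  proof -
    have m: "max u c \<in> I" "min u c \<in> I" using u c by (auto simp: max_def min_def)
    \<comment> \<open>\<open>b\<close> lies strictly beyond \<open>u\<close> and \<open>c\<close>
      unless their maximum is the right end of \<open>I\<close>. With \<open>a\<close> chosen
      likewise, \<open>{a..b}\<close> is a neighbourhood of \<open>u\<close> relative to
      \<open>I\<close>.\<close>
    obtain b where b: "b \<in> I" "max u c \<le> b" "max u c < b \<or> (\<forall>x\<in>I. x \<le> b)"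
      using m(1) by (metis linorder_not_less order.order_iff_strict)
    obtain a where a: "a \<in> I" "a \<le> min u c" "a < min u c \<or> (\<forall>x\<in>I. a \<le> x)"
      using m(2) by (metis linorder_not_less order.order_iff_strict)
    have sub: "{a..b} \<subseteq> I"
      using a(1) b(1) assms(1) by (meson atLeastAtMost_iff mem_is_interval_1_I subsetI)
    have "((\<lambda>u. LBINT y=c..u. s y) has_vector_derivative s u) (at u within {a..b})"
      using a(2) b(2) continuous_on_subset[OF assms(2) sub] by (intro interval_integral_FTC2) auto
    moreover have "at u within {a..b} = at u within I"
    proof (rule at_within_nhd)
      \<comment> \<open>An open set in which \<open>{a..b}\<close> and \<open>I\<close> coincide: it
        is bounded only on the sides where the compact interval may stop before \<open>I\<close>
        does.\<close>
      let ?U = "{x. (a < min u c \<longrightarrow> a < x) \<and> (max u c < b \<longrightarrow> x < b)}"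
      have "?U = (if a < min u c then {a<..} else UNIV) \<inter> (if max u c < b then {..<b} else UNIV)"
        by auto
      then show "open ?U" by (rule ssubst) (intro open_Int; simp)
      show "u \<in> ?U" by auto
      show "{a..b} \<inter> ?U - {u} = I \<inter> ?U - {u}"
        using sub a(3) b(3) by (auto simp: less_imp_le)
    qed
    ultimately show ?thesis
      by (simp add: has_real_derivative_iff_has_vector_derivative)
  qed
  then show thesis by (rule that)
qed auto

text \<open>Since \<open>H'\<close> is nonpositive inside \<open>I\<close>, 1 \<le> sqrt(1 + H'^2)
  \<le> 1 - H' there. Hence F(u) - u and u - H(u) - F(u) are nondecreasing in u.\<close>

lemma arc_length_bounds:
  fixes F H H' :: "real \<Rightarrow> real"
  assumes "is_interval I" "antimono_on I H"
    and H: "\<And>u. u \<in> I \<Longrightarrow> (H has_real_derivative H' u) (at u within I)"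
    and F: "\<And>u. u \<in> I \<Longrightarrow> (F has_real_derivative sqrt (1 + (H' u)\<^sup>2)) (at u within I)"
    and "u \<in> I" "v \<in> I"
  shows "\<bar>u - v\<bar> \<le> \<bar>F u - F v\<bar>" and "\<bar>F u - F v\<bar> \<le> \<bar>u - v\<bar> + \<bar>H u - H v\<bar>"
proof -
  have *: "v - u \<le> F v - F u \<and> F v - F u \<le> (v - u) + (H u - H v)"
    if "u \<in> I" "v \<in> I" "u \<le> v" for u v
  proof -
    have sub: "{u..v} \<subseteq> I"
      using that assms(1) by (meson atLeastAtMost_iff mem_is_interval_1_I subsetI)
    \<comment> \<open>Strictly between \<open>u\<close> and \<open>v\<close> the derivatives within
      \<open>I\<close> are ordinary ones. At \<open>u\<close> and \<open>v\<close>, which may be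
      endpoints of \<open>I\<close>, continuity is enough.\<close>
    have int: "x \<in> interior I" if "u < x" "x < v" for x
      using interior_mono[OF sub] that by auto
    have atI: "at x within I = at x" if "u < x" "x < v" for x
      using int[OF that] by (rule at_within_interior)
    have Hx: "(H has_real_derivative H' x) (at x)"
      and Fx: "(F has_real_derivative sqrt (1 + (H' x)\<^sup>2)) (at x)" if "u < x" "x < v" for x
      using H[of x] F[of x] atI[OF that] int[OF that] interior_subset[of I] by auto
    have H'0: "H' x \<le> 0" if "u < x" "x < v" for x
    proof -
      have "mono_on I (\<lambda>x. - H x)"
        using assms(2) by (auto simp: monotone_on_def)
      then have "- H' x \<ge> 0"
        using Hx[OF that] int[OF that]
        by (intro mono_on_imp_deriv_nonneg[of I "\<lambda>x. - H x" _ x]) (auto intro: DERIV_minus)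
      then show ?thesis by simp
    qed
    have cont: "continuous_on {u..v} F" "continuous_on {u..v} H"
      using DERIV_continuous_on[OF F] DERIV_continuous_on[OF H] sub continuous_on_subset by blast+
    have "F u - u \<le> F v - v"
    proof (rule DERIV_nonneg_imp_increasing_open[OF that(3)])
      show "\<exists>y. ((\<lambda>x. F x - x) has_real_derivative y) (at x) \<and> 0 \<le> y" if "u < x" "x < v" for x
        using Fx[OF that] by (intro exI[of _ "sqrt (1 + (H' x)\<^sup>2) - 1"]) (auto intro!: derivative_eq_intros)
    qed (intro continuous_intros cont)
    moreover have "u - H u - F u \<le> v - H v - F v"
    proof (rule DERIV_nonneg_imp_increasing_open[OF that(3)])
      show "\<exists>y. ((\<lambda>x. x - H x - F x) has_real_derivative y) (at x) \<and> 0 \<le> y" if "u < x" "x < v" for x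
      proof (intro exI conjI)
        show "((\<lambda>x. x - H x - F x) has_real_derivative 1 - H' x - sqrt (1 + (H' x)\<^sup>2)) (at x)"
          using Fx[OF that] Hx[OF that] by (auto intro!: derivative_eq_intros)
        have "sqrt (1 + (H' x)\<^sup>2) \<le> 1 - H' x"
          using H'0[OF that] by (intro real_le_lsqrt) (auto simp: power2_eq_square algebra_simps)
        then show "0 \<le> 1 - H' x - sqrt (1 + (H' x)\<^sup>2)" by simp
      qed
    qed (intro continuous_intros cont)
    ultimately show ?thesis by simp
  qed
  show "\<bar>u - v\<bar> \<le> \<bar>F u - F v\<bar>" "\<bar>F u - F v\<bar> \<le> \<bar>u - v\<bar> + \<bar>H u - H v\<bar>"
    using *[OF assms(5,6)] *[OF assms(6,5)] by linarith+
qed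

text \<open>The gradients of the first coordinate and of \<open>w\<close> are those of the second
  coordinate times \<open>H'\<close> and sqrt(1 + H'^2). So the quadratic expressions in the
  criticality of \<open>f\<close> coincide with those of the scalar function
  \<open>w\<close>.\<close>

lemma arc_length_harmonic:
  fixes f :: "real ^ 'n \<Rightarrow> real ^ 3"
  assumes "open \<Omega>" "harmonic_curve f \<Omega>"
    and fI: "\<And>p. p \<in> \<Omega> \<Longrightarrow> f p $ 2 \<in> I" "\<And>p. p \<in> \<Omega> \<Longrightarrow> f p $ 1 = H (f p $ 2)"
    and H: "\<And>u. u \<in> I \<Longrightarrow> (H has_real_derivative H' u) (at u within I)"
    and F: "\<And>u. u \<in> I \<Longrightarrow> (F has_real_derivative sqrt (1 + (H' u)\<^sup>2)) (at u within I)"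
    and "Ck_interval 2 I F"
  defines "w \<equiv> \<lambda>p. F (f p $ 2)"
  shows "Ck_on 2 w \<Omega>" "p \<in> \<Omega> \<Longrightarrow> laplacian w p = 0"
proof -
  have y: "Ck_on 2 (\<lambda>p. f p $ 2) \<Omega>"
    using assms(1,2) by (auto simp: harmonic_curve_def intro: Ck_on_vec_nth)
  show w: "Ck_on 2 w \<Omega>"
    unfolding w_def by (rule Ck_on_compose[OF assms(1) y assms(7) fI(1)])
  note yd = Ck_on_2D(5)[OF assms(1) y]
  have pdx: "partial_deriv i (\<lambda>p. f p $ 1) p = H' (f p $ 2) * partial_deriv i (\<lambda>p. f p $ 2) p"
    if "p \<in> \<Omega>" for p i
    using partial_deriv_cong[OF assms(1) that, of "\<lambda>p. f p $ 1" "\<lambda>p. H (f p $ 2)" i] fI(2)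
      partial_deriv_compose(2)[OF assms(1) that yd[OF that] fI(1) H[OF fI(1)[OF that]]] by simp
  have pdw: "partial_deriv i w p = sqrt (1 + (H' (f p $ 2))\<^sup>2) * partial_deriv i (\<lambda>p. f p $ 2) p"
    if "p \<in> \<Omega>" for p i
    using partial_deriv_compose(2)[OF assms(1) that yd[OF that] fI(1) F[OF fI(1)[OF that]]]
    by (simp add: w_def)
  have metric: "partial_deriv i (\<lambda>p. f p $ 1) p * partial_deriv j (\<lambda>p. f p $ 1) p
      + partial_deriv i (\<lambda>p. f p $ 2) p * partial_deriv j (\<lambda>p. f p $ 2) p
      = partial_deriv i w p * partial_deriv j w p" if "p \<in> \<Omega>" for p i j
  proof -
    let ?s = "sqrt (1 + (H' (f p $ 2))\<^sup>2)"
    have "partial_deriv i w p * partial_deriv j w p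
      = (?s * ?s) * (partial_deriv i (\<lambda>p. f p $ 2) p * partial_deriv j (\<lambda>p. f p $ 2) p)"
      unfolding pdw[OF that] by (simp only: mult_ac)
    also have "?s * ?s = 1 + (H' (f p $ 2))\<^sup>2"
      by (simp add: add_nonneg_nonneg)
    finally have "partial_deriv i w p * partial_deriv j w p
      = (1 + (H' (f p $ 2))\<^sup>2) * (partial_deriv i (\<lambda>p. f p $ 2) p * partial_deriv j (\<lambda>p. f p $ 2) p)" .
    then show ?thesis
      unfolding pdx[OF that] by (simp add: power2_eq_square algebra_simps)
  qed
  show "laplacian w p = 0" if "p \<in> \<Omega>"
  proof (rule critical_imp_harmonic[OF assms(1) w that])
    fix \<phi> :: "real ^ 'n \<Rightarrow> real" and \<gamma>
    assume \<phi>: "test_function \<Omega> \<phi>"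
    have "energy_critical f \<Omega>" using assms(2) by (simp add: harmonic_curve_def)
    from this[unfolded energy_critical_def Let_def, rule_format, OF \<phi>]
    have "0 = (LINT p:\<Omega>|lborel.
           (\<Sum>\<alpha>\<in>UNIV. (partial_deriv \<alpha> (\<lambda>p. f p $ 1) p)\<^sup>2 + (partial_deriv \<alpha> (\<lambda>p. f p $ 2) p)\<^sup>2) * partial_deriv \<gamma> \<phi> p
           - 2 * (\<Sum>\<beta>\<in>UNIV. (partial_deriv \<beta> (\<lambda>p. f p $ 1) p * partial_deriv \<gamma> (\<lambda>p. f p $ 1) p
                              + partial_deriv \<beta> (\<lambda>p. f p $ 2) p * partial_deriv \<gamma> (\<lambda>p. f p $ 2) p)
                            * partial_deriv \<beta> \<phi> p))"
      by (rule sym)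
    also have "\<dots> = (LINT p:\<Omega>|lborel. (\<Sum>\<alpha>\<in>UNIV. (partial_deriv \<alpha> w p)\<^sup>2) * partial_deriv \<gamma> \<phi> p
        - 2 * (\<Sum>\<beta>\<in>UNIV. partial_deriv \<beta> w p * partial_deriv \<gamma> w p * partial_deriv \<beta> \<phi> p))"
      using assms(1) by (intro set_lebesgue_integral_cong) (auto simp: metric power2_eq_square)
    finally show "(LINT p:\<Omega>|lborel. (\<Sum>\<alpha>\<in>UNIV. (partial_deriv \<alpha> w p)\<^sup>2) * partial_deriv \<gamma> \<phi> p
        - 2 * (\<Sum>\<beta>\<in>UNIV. partial_deriv \<beta> w p * partial_deriv \<gamma> w p * partial_deriv \<beta> \<phi> p)) = 0" by simp
  qed
qed

section \<open>Uniqueness for equal boundary values\<close>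

theorem corollary4p8:
  fixes f g :: "real ^ 'n \<Rightarrow> real ^ 3"
    and \<Omega> :: "(real ^ 'n) set"
    and I :: "real set"
    and H H' H'' H''' :: "real \<Rightarrow> real"
  assumes "open \<Omega>" and "connected \<Omega>" and "\<Omega> \<noteq> {}" and "bounded \<Omega>"
    and "harmonic_curve f \<Omega>" and "harmonic_curve g \<Omega>"
    and "corresponds_to f \<Omega> I H" and "corresponds_to g \<Omega> I H"
    and "continuous_on (closure \<Omega>) f" and "continuous_on (closure \<Omega>) g"
    and "\<And>p. p \<in> frontier \<Omega> \<Longrightarrow> f p = g p"
    and "Ck_interval 3 I H"
    and "\<And>u. u \<in> I \<Longrightarrow> (H has_real_derivative H' u) (at u within I)"
    and "\<And>u. u \<in> I \<Longrightarrow> (H' has_real_derivative H'' u) (at u within I)"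
    and "\<And>u. u \<in> I \<Longrightarrow> (H'' has_real_derivative H''' u) (at u within I)"
    and "antimono_on I H"
    and "\<And>u. u \<in> I \<Longrightarrow>
      H''' u * H' u * (1 + (H' u)\<^sup>2) + (H'' u)\<^sup>2 * (1 - (H' u)\<^sup>2) \<le> 0"
    and "\<And>u. u \<in> I \<Longrightarrow>
      H''' u * (u + H u * H' u) * (1 + (H' u)\<^sup>2) + (H'' u)\<^sup>2 * (1 - (H' u)\<^sup>2)
        + H'' u * (1 + (H' u)\<^sup>2 - 2 * u * H' u) \<le> 0"
  shows "\<forall>p \<in> closure \<Omega>. f p = g p"
proof -
  note H' = assms(13) and H'' = assms(14)
  have I: "is_interval I" and fI: "\<And>p. p \<in> \<Omega> \<Longrightarrow> f p $ 2 \<in> I" "\<And>p. p \<in> \<Omega> \<Longrightarrow> f p $ 1 = H (f p $ 2)"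
    and gI: "\<And>p. p \<in> \<Omega> \<Longrightarrow> g p $ 2 \<in> I" "\<And>p. p \<in> \<Omega> \<Longrightarrow> g p $ 1 = H (g p $ 2)"
    using assms(7,8) by (auto simp: corresponds_to_def)
  define s where "s u = sqrt (1 + (H' u)\<^sup>2)" for u
  have pos: "0 < 1 + (H' u)\<^sup>2" for u by (simp add: add_pos_nonneg)
  \<comment> \<open>The radicand is at least 1, so \<open>s\<close> is C^1, with \<open>H''\<close>
    continuous because it has the derivative \<open>H'''\<close>. This makes \<open>F\<close> of
    class C^2.\<close>
  have ds: "(s has_real_derivative H' u * H'' u / s u) (at u within I)" if "u \<in> I" for u
    unfolding s_def using pos[of u]
    by (auto intro!: derivative_eq_intros H''[OF that] simp: divide_simps)
  have cont: "continuous_on I H'" "continuous_on I H''" "continuous_on I s"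
    using DERIV_continuous_on[OF H''] DERIV_continuous_on[OF assms(15)] DERIV_continuous_on[OF ds] by blast+
  have "s u \<noteq> 0" for u using pos[of u] by (simp add: s_def)
  then have cont': "continuous_on I (\<lambda>u. H' u * H'' u / s u)"
    by (intro continuous_intros cont) auto
  obtain F where F: "\<And>u. u \<in> I \<Longrightarrow> (F has_real_derivative s u) (at u within I)"
    using continuous_on_interval_antiderivative[OF I cont(3)] by metis
  have "Ck_interval (Suc 0) I s"
    unfolding Ck_interval.simps
    by (rule exI[of _ "\<lambda>u. H' u * H'' u / s u"]) (simp add: ds cont')
  then have F2: "Ck_interval 2 I F"
    unfolding numeral_2_eq_2 Ck_interval.simps(2)[of "Suc 0"]
    by (intro exI[of _ s]) (simp add: F)
  note Fs = F[unfolded s_def]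
  have len: "\<bar>u - v\<bar> \<le> \<bar>F u - F v\<bar>" "\<bar>F u - F v\<bar> \<le> \<bar>u - v\<bar> + \<bar>H u - H v\<bar>"
    if "u \<in> I" "v \<in> I" for u v
    by (rule arc_length_bounds[OF I assms(16) H' Fs that]; assumption)+
  have wf: "Ck_on 2 (\<lambda>p. F (f p $ 2)) \<Omega>" "\<And>p. p \<in> \<Omega> \<Longrightarrow> laplacian (\<lambda>p. F (f p $ 2)) p = 0"
    by (rule arc_length_harmonic[OF assms(1,5) fI H' Fs F2]; assumption)+
  have wg: "Ck_on 2 (\<lambda>p. F (g p $ 2)) \<Omega>" "\<And>p. p \<in> \<Omega> \<Longrightarrow> laplacian (\<lambda>p. F (g p $ 2)) p = 0"
    by (rule arc_length_harmonic[OF assms(1,6) gI H' Fs F2]; assumption)+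

  \<comment> \<open>On the boundary the second coordinate may lie outside \<open>I\<close>, where
    nothing is known about \<open>F\<close>. The default 0 is the limit of the difference
    there.\<close>
  define d where "d p = (if p \<in> \<Omega> then F (f p $ 2) - F (g p $ 2) else 0)" for p
  have d2: "Ck_on 2 d \<Omega>"
    by (rule Ck_on_cong[OF assms(1) _ Ck_on_diff[OF assms(1) wf(1) wg(1)]]) (auto simp: d_def)
  have pd: "partial_deriv i d p = partial_deriv i (\<lambda>p. F (f p $ 2)) p - partial_deriv i (\<lambda>p. F (g p $ 2)) p"
    if "p \<in> \<Omega>" for p i
    using partial_deriv_cong[OF assms(1) that, of d "\<lambda>p. F (f p $ 2) - F (g p $ 2)" i]
      partial_deriv_diff[OF Ck_on_2D(5)[OF assms(1) wf(1) that] Ck_on_2D(5)[OF assms(1) wg(1) that]]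
    by (simp add: d_def)
  have lap: "laplacian d p = 0" if "p \<in> \<Omega>" for p
  proof -
    have "partial_deriv i (partial_deriv i d) p = partial_deriv i (partial_deriv i (\<lambda>p. F (f p $ 2))) p
        - partial_deriv i (partial_deriv i (\<lambda>p. F (g p $ 2))) p" for i
      using partial_deriv_cong[of \<Omega> p "partial_deriv i d" "\<lambda>p. partial_deriv i (\<lambda>p. F (f p $ 2)) p
          - partial_deriv i (\<lambda>p. F (g p $ 2)) p" i, OF assms(1) that pd]
        partial_deriv_diff[OF Ck_on_2D(6)[OF assms(1) wf(1) that] Ck_on_2D(6)[OF assms(1) wg(1) that]]
      by simp
    then show ?thesis
      using wf(2)[OF that] wg(2)[OF that] by (simp add: laplacian_def sum_subtractf)
  qed
  \<comment> \<open>Here \<open>F\<close> and \<open>H\<close> are eliminated: the right-hand side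
    involves only coordinates of \<open>f\<close> and \<open>g\<close>, which are continuous up to
    the boundary.\<close>
  have bnd: "norm (d p) \<le> \<bar>f p $ 2 - g p $ 2\<bar> + \<bar>f p $ 1 - g p $ 1\<bar>" for p
    using len(2)[of "f p $ 2" "g p $ 2"] fI[of p] gI[of p] by (auto simp: d_def)
  have dcont: "continuous_on (closure \<Omega>) d"
    unfolding continuous_on_def
  proof
    fix p assume p: "p \<in> closure \<Omega>"
    show "(d \<longlongrightarrow> d p) (at p within closure \<Omega>)"
    proof (cases "p \<in> \<Omega>")
      case True
      then have "isCont d p"
        using Ck_on_2D(4)[OF assms(1) d2] assms(1) by (simp add: continuous_on_eq_continuous_at)
      then show ?thesis
        using continuous_at_imp_continuous_at_within continuous_within by blast
    next
      case False
      then have "f p = g p"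
        using p assms(1,11) by (simp add: frontier_def interior_open)
      moreover have "((\<lambda>q. \<bar>f q $ 2 - g q $ 2\<bar> + \<bar>f q $ 1 - g q $ 1\<bar>) \<longlongrightarrow>
          \<bar>f p $ 2 - g p $ 2\<bar> + \<bar>f p $ 1 - g p $ 1\<bar>) (at p within closure \<Omega>)"
        using assms(9,10) p by (intro tendsto_intros) (auto simp: continuous_on_def)
      ultimately have "(d \<longlongrightarrow> 0) (at p within closure \<Omega>)"
        using bnd by (intro Lim_null_comparison[of d]) auto
      with False show ?thesis by (simp add: d_def)
    qed
  qed
  have d0: "d p = 0" if "p \<in> \<Omega>" for p
  proof (rule antisym)
    have fr: "q \<notin> \<Omega>" if "q \<in> frontier \<Omega>" for q
      using that assms(1) by (simp add: frontier_def interior_open)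
    have pc: "p \<in> closure \<Omega>" using that closure_subset by blast
    show "d p \<le> 0"
      using weak_maximum_principle[OF assms(1,4) d2 dcont lap _ pc] fr by (simp add: d_def)
    \<comment> \<open>The maximum principle is also applied to the negative of \<open>d\<close>,
      written as a difference so that the rules for differences apply.\<close>
    have n2: "Ck_on 2 (\<lambda>p. 0 - d p) \<Omega>"
      by (intro Ck_on_diff Ck_on_const assms(1) d2)
    have nlap: "laplacian (\<lambda>p. 0 - d p) q = 0" if "q \<in> \<Omega>" for q
    proof -
      have neg: "partial_deriv i (\<lambda>p. 0 - d p) r = 0 - partial_deriv i d r" if "r \<in> \<Omega>" for i r
        using partial_deriv_diff[OF _ Ck_on_2D(5)[OF assms(1) d2 that], of "\<lambda>_. 0" i] by simp
      have "partial_deriv i (partial_deriv i (\<lambda>p. 0 - d p)) q = 0 - partial_deriv i (partial_deriv i d) q" for i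
        using partial_deriv_cong[of \<Omega> q "partial_deriv i (\<lambda>p. 0 - d p)" "\<lambda>p. 0 - partial_deriv i d p" i,
            OF assms(1) \<open>q \<in> \<Omega>\<close> neg]
          partial_deriv_diff[OF _ Ck_on_2D(6)[OF assms(1) d2 \<open>q \<in> \<Omega>\<close>], of "\<lambda>_. 0" i] by simp
      then show ?thesis using lap[OF \<open>q \<in> \<Omega>\<close>] by (simp add: laplacian_def sum_negf)
    qed
    have ncont: "continuous_on (closure \<Omega>) (\<lambda>p. 0 - d p)"
      by (intro continuous_intros dcont)
    have "0 - d p \<le> 0"
      using weak_maximum_principle[OF assms(1,4) n2 ncont nlap _ pc] fr by (simp add: d_def)
    then show "0 \<le> d p" by simp
  qed
  \<comment> \<open>By the lower length bound \<open>F\<close> is injective on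
    \<open>I\<close>.\<close>
  have y: "f p $ 2 = g p $ 2" if "p \<in> \<Omega>" for p
    using len(1)[OF fI(1)[OF that] gI(1)[OF that]] d0[OF that] that by (simp add: d_def)
  then have x: "f p $ 1 = g p $ 1" if "p \<in> \<Omega>" for p
    using that fI(2) gI(2) by simp

  \<comment> \<open>Equality of the third coordinate\<close>
  define t where "t p = f p $ 3 - g p $ 3" for p
  have "(t has_derivative (\<lambda>v. 0)) (at p)" if "p \<in> \<Omega>" for p
  proof -
    let ?A = "frechet_derivative f (at p)" and ?B = "frechet_derivative g (at p)"
    have A: "((\<lambda>p. f p $ j) has_derivative (\<lambda>v. ?A v $ j)) (at p)"
      and B: "((\<lambda>p. g p $ j) has_derivative (\<lambda>v. ?B v $ j)) (at p)" for j
      using assms(5,6) Ck_on_2D[of \<Omega>] that assms(1)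
      by (auto simp: harmonic_curve_def numeral_2_eq_2 differentiable_on_eq_differentiable_at
          frechet_derivative_works intro!: bounded_linear.has_derivative[OF bounded_linear_vec_nth])
    have "?A v $ j = ?B v $ j" if "j = 1 \<or> j = 2" for j v
    proof -
      have "((\<lambda>p. f p $ j) has_derivative (\<lambda>v. ?B v $ j)) (at p)"
        using that x y
        by (intro has_derivative_transform_within_open[OF B assms(1) \<open>p \<in> \<Omega>\<close>]) auto
      then show ?thesis using has_derivative_unique[OF A] by metis
    qed
    moreover have "contact_form (f p) (?A v) = 0" "contact_form (g p) (?B v) = 0" for v
      using assms(5,6) that by (auto simp: harmonic_curve_def isotropic_def Let_def)
    \<comment> \<open>The contact condition expresses the third component of the derivative through
      the first two coordinates and their derivatives, and in these \<open>f\<close> and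
      \<open>g\<close> agree.\<close>
    ultimately have "?A v $ 3 - ?B v $ 3 = 0" for v
      using x[OF that] y[OF that] by (simp add: contact_form_def) (smt (verit))
    then show ?thesis
      using has_derivative_diff[OF A[of 3] B[of 3]] by (simp add: t_def[abs_def])
  qed
  then have "t constant_on \<Omega>"
    using has_derivative_zero_connected_constant_on[of \<Omega> "{}" t] assms(1,2) has_derivative_at_withinI
    by (metis Diff_empty differentiable_def differentiable_imp_continuous_within
        continuous_at_imp_continuous_on finite.emptyI)
  moreover have tcont: "continuous_on (closure \<Omega>) t"
    unfolding t_def by (intro continuous_intros continuous_on_component assms(9,10))
  ultimately obtain c where c: "\<And>p. p \<in> closure \<Omega> \<Longrightarrow> t p = c"
    using constant_on_closureI unfolding constant_on_def by metis
  \<comment> \<open>A nonempty bounded set is not the whole space and so has a boundary point. There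
    \<open>t\<close> vanishes, which determines the constant \<open>c\<close>.\<close>
  have "frontier \<Omega> \<noteq> {}"
    using assms(3,4) not_bounded_UNIV frontier_eq_empty by blast
  then obtain q where "q \<in> frontier \<Omega>" by blast
  with assms(11) c[of q] have "c = 0" by (simp add: t_def frontier_def)
  then have "f p = g p" if "p \<in> \<Omega>" for p
    using c[of p] x[OF that] y[OF that] that closure_subset
    by (auto simp: vec_eq_iff forall_3 t_def)
  with assms(1,11) show ?thesis
    by (auto simp: frontier_def interior_open)
qed

end
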